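(* In the setting described in the context, with POD space $X=L^2(\Omega)$ and ROM initial condition $u_r^1=\Pi_r^Xu^1$, the following hold. (1) (Error norm space $Y=L^2(\Omega)$.) Consider the pointwise ROM error bound $\max_k\|e^k\|_{L^2}^2\le C(\Lambda_r+\Lambda_r^1)$ with $\Lambda_r=\sum_{i=r+1}^s\lambda_i^{DQ1}\|\varphi_i-R_r\varphi_i\|_{L^2}^2$ and $\Lambda_r^1=\|\phi_r^1\|_{L^2}^2$. If there exists a constant $C_0$ (independent of the discretization parameters) such that $\|\varphi_i-R_r\varphi_i\|_{L^2}\le C_0$ for $r+1\le i\le s$, then this error is optimal-I, i.e. there is a constant $C$, not depending on any discretization parameter, with $$\Lambda_r+\Lambda_r^1\le C\sum_{i=r+1}^s\lambda_i^{DQ1}\|\varphi_i\|_{L^2}^2.$$ In this case optimal-I is equivalent to optimal-II. (2) (Error norm space $Y=H_0^1(\Omega)$.) Consider the pointwise ROM error bound $\max_k\|\nabla e^k\|_{L^2}^2\le C(\Lambda_r+\Lambda_r^1)$ with $\Lambda_r=\sum_{i=r+1}^s\lambda_i^{DQ1}\big(\|\varphi_i-R_r\varphi_i\|_{L^2}^2+\|\nabla(\varphi_i-R_r\varphi_i)\|_{L^2}^2\big)$ and $\Lambda_r^1=\|\phi_r^1\|_{H_0^1}^2$. This error is optimal-I, i.e. there is a constant $C$, not depending on any discretization parameter, with $$\Lambda_r+\Lambda_r^1\le C\sum_{i=r+1}^s\lambda_i^{DQ1}\|\varphi_i\|_{H_0^1}^2.$$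
   Context: All function spaces are real. $\Omega\subset\mathbb{R}^d$ ($d\ge1$) is an open bounded domain with Lipschitz continuous boundary, $V=H_0^1(\Omega)$ with inner product $(g,h)_{H_0^1}=(\nabla g,\nabla h)_{L^2}$, $\nu>0$ is a constant, $T>0$ is fixed, $N\ge2$, $\Delta t=T/(N-1)$, $t_n=(n-1)\Delta t$, and $f$ is a given forcing function, with $f^n=f(t_n)$. $V^h\subset V$ is a standard conforming (finite-dimensional) finite element space. Backward Euler finite element solution: $\{u^n\}_{n=1}^N\subset V^h$, with $u^1$ the given initial condition and, for $n=1,\dots,N-1$, $$\Big(\tfrac{u^{n+1}-u^n}{\Delta t},v\Big)_{L^2}+\nu(\nabla u^{n+1},\nabla v)_{L^2}=(f^{n+1},v)_{L^2}\quad\forall v\in V^h.$$ POD modes: write $\partial z^n=(z^{n+1}-z^n)/\Delta t$. Let $S=\mathbb{R}^N$ with inner product $(g,h)_S=g^1h^1+\Delta t\sum_{j=2}^Ng^jh^j$, and $K_1:S\to X$, $K_1f=f^1u^1+\sum_{j=1}^{N-1}\Delta t f^{j+1}\partial u^j$. Its singular value decomposition has singular values $(\lambda_i^{DQ1})^{1/2}$ (nonincreasing) and orthonormal singular vectors $f_i\in S$, $\varphi_i\in X$, with $K_1f_i=(\lambda_i^{DQ1})^{1/2}\varphi_i$. The $\varphi_i$ are the POD modes, the $\lambda_i^{DQ1}$ the POD eigenvalues, and $s$ is the number of positive POD eigenvalues. $r$ is a positive integer with $\varphi_1,\dots,\varphi_r\in V^h$, and $X_r=V_r^h=\mathrm{span}\{\varphi_j\}_{j=1}^r\subset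 V^h$. $\Pi_r^X:X\to X$ is the orthogonal projection onto $V_r^h$, and $\Pi_r^Y:Y\to Y$ the $Y$-orthogonal projection onto $V_r^h$. BE-POD-ROM: $\{u_r^n\}_{n=1}^N\subset V_r^h$ with $u_r^1=\Pi_r^Xu^1$ and, for $n=1,\dots,N-1$, $$\Big(\tfrac{u_r^{n+1}-u_r^n}{\Delta t},v_r\Big)_{L^2}+\nu(\nabla u_r^{n+1},\nabla v_r)_{L^2}=(f^{n+1},v_r)_{L^2}\quad\forall v_r\in V_r^h.$$ The ROM error is $e^k=u^k-u_r^k$. The Ritz projection $R_r:V\to V_r^h$ is defined by $(\nabla(w-R_rw),\nabla v_r)_{L^2}=0$ for all $v_r\in V_r^h$, and $\phi_r^n=u_r^n-R_ru^n$ (distinct from the POD modes $\varphi_i$). Optimality: given a bound $\max_{1\le k\le N}\|e^k\|_Y^2\le C(\Lambda_r+\Lambda_r^1)$, where $\Lambda_r$ is the ROM discretization error and $\Lambda_r^1$ is the ROM discretization error for the initial condition, the total ROM discretization error $\Lambda_r+\Lambda_r^1$ is called optimal-I if there is a constant $C$ with $\Lambda_r+\Lambda_r^1\le C\sum_{i=r+1}^s\lambda_i^{DQ1}\|\varphi_i\|_Y^2$, and optimal-II if there is a constant $C$ with $\Lambda_r+\Lambda_r^1\le C\sum_{i=r+1}^s\lambda_i^{DQ1}\|\varphi_i-\Pi_r^Y\varphi_i\|_Y^2$. These constants may depend on the solution data and the problem data, but not on any discretization parameter ($V^h$, $N$, $\Delta t$, $r$). *)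

theory Defs
  imports "HOL-Analysis.Analysis"
begin

section \<open>Lipschitz domains\<close>

text \<open>Near every boundary point the set is, in suitable orthonormal coordinates whose last axis
  is \<open>e\<close>, the strict epigraph of a Lipschitz function \<open>\<gamma>\<close> of the remaining coordinates. The vector
  \<open>y - (y \<bullet> e) *\<^sub>R e\<close> is the projection of \<open>y\<close> onto the hyperplane orthogonal to \<open>e\<close>; for a
  one-dimensional space that hyperplane is \<open>{0}\<close>.\<close>

definition lipschitz_boundary :: "'a::euclidean_space set \<Rightarrow> bool" where
  "lipschitz_boundary \<Omega> \<longleftrightarrow>
     (\<forall>x\<in>frontier \<Omega>. \<exists>e \<rho> L (\<gamma> :: 'a \<Rightarrow> real).
        norm e = 1 \<and> \<rho> > 0 \<and> L-lipschitz_on {z. z \<bullet> e = 0} \<gamma> \<and>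
        \<Omega> \<inter> ball x \<rho> = {y \<in> ball x \<rho>. y \<bullet> e > \<gamma> (y - (y \<bullet> e) *\<^sub>R e)})"

definition bounded_lipschitz_domain :: "'a::euclidean_space set \<Rightarrow> bool" where
  "bounded_lipschitz_domain \<Omega> \<longleftrightarrow>
     open \<Omega> \<and> connected \<Omega> \<and> \<Omega> \<noteq> {} \<and> bounded \<Omega> \<and> lipschitz_boundary \<Omega>"


section \<open>The spaces \<open>L\<^sup>2(\<Omega>)\<close> and \<open>H\<^sup>1\<^sub>0(\<Omega>)\<close>\<close>

text \<open>Elements of the function spaces are represented by functions on the whole space, of which
  only the values on \<open>\<Omega>\<close> matter, and equality in the spaces is equality almost everywhere on \<open>\<Omega>\<close>.
  The definitions for \<open>L\<^sup>2\<close> cover scalar and vector valued functions; for the former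
  \<open>\<bullet>\<close> is multiplication.\<close>

definition l2_space :: "'a::euclidean_space set \<Rightarrow> ('a \<Rightarrow> 'b::euclidean_space) set" where
  "l2_space \<Omega> = {g. g \<in> borel_measurable (lebesgue_on \<Omega>) \<and>
                     integrable (lebesgue_on \<Omega>) (\<lambda>x. (norm (g x))\<^sup>2)}"

definition l2_inner ::
    "'a::euclidean_space set \<Rightarrow> ('a \<Rightarrow> 'b::euclidean_space) \<Rightarrow> ('a \<Rightarrow> 'b) \<Rightarrow> real" where
  "l2_inner \<Omega> g h = (LINT x|lebesgue_on \<Omega>. g x \<bullet> h x)"

definition ae_eq :: "'a::euclidean_space set \<Rightarrow> ('a \<Rightarrow> real) \<Rightarrow> ('a \<Rightarrow> real) \<Rightarrow> bool" where
  "ae_eq \<Omega> g h \<longleftrightarrow> (AE x in lebesgue_on \<Omega>. g x = h x)"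

definition partial :: "'a::euclidean_space \<Rightarrow> ('a \<Rightarrow> real) \<Rightarrow> 'a \<Rightarrow> real" where
  "partial b \<psi> x = frechet_derivative \<psi> (at x) b"

primrec k_smooth :: "nat \<Rightarrow> ('a::euclidean_space \<Rightarrow> real) \<Rightarrow> bool" where
  "k_smooth 0 \<psi> \<longleftrightarrow> continuous_on UNIV \<psi>"
| "k_smooth (Suc k) \<psi> \<longleftrightarrow>
     (\<forall>x. \<psi> differentiable (at x)) \<and> (\<forall>b\<in>Basis. k_smooth k (partial b \<psi>))"

definition test_function :: "'a::euclidean_space set \<Rightarrow> ('a \<Rightarrow> real) \<Rightarrow> bool" where
  "test_function \<Omega> \<psi> \<longleftrightarrow>
     (\<forall>k. k_smooth k \<psi>) \<and> (\<exists>K. compact K \<and> K \<subseteq> \<Omega> \<and> (\<forall>x. x \<notin> K \<longrightarrow> \<psi> x = 0))"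

definition is_weak_gradient ::
    "'a::euclidean_space set \<Rightarrow> ('a \<Rightarrow> real) \<Rightarrow> ('a \<Rightarrow> 'a) \<Rightarrow> bool" where
  "is_weak_gradient \<Omega> g G \<longleftrightarrow> G \<in> l2_space \<Omega> \<and>
     (\<forall>\<psi> b. test_function \<Omega> \<psi> \<longrightarrow> b \<in> Basis \<longrightarrow>
        (LINT x|lebesgue_on \<Omega>. g x * partial b \<psi> x) = - (LINT x|lebesgue_on \<Omega>. (G x \<bullet> b) * \<psi> x))"

text \<open>The weak gradient is determined almost everywhere on an open set; the choice only fixes a
  representative.\<close>

definition wgrad :: "'a::euclidean_space set \<Rightarrow> ('a \<Rightarrow> real) \<Rightarrow> 'a \<Rightarrow> 'a" where
  "wgrad \<Omega> g = (SOME G. is_weak_gradient \<Omega> g G)"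

definition h1_space :: "'a::euclidean_space set \<Rightarrow> ('a \<Rightarrow> real) set" where
  "h1_space \<Omega> = {g \<in> l2_space \<Omega>. \<exists>G. is_weak_gradient \<Omega> g G}"

definition h1_norm :: "'a::euclidean_space set \<Rightarrow> ('a \<Rightarrow> real) \<Rightarrow> real" where
  "h1_norm \<Omega> g = sqrt (l2_inner \<Omega> g g + l2_inner \<Omega> (wgrad \<Omega> g) (wgrad \<Omega> g))"

text \<open>\<open>H\<^sup>1\<^sub>0(\<Omega>)\<close> is the closure of the test functions in \<open>H\<^sup>1(\<Omega>)\<close>.\<close>

definition h10_space :: "'a::euclidean_space set \<Rightarrow> ('a \<Rightarrow> real) set" where
  "h10_space \<Omega> = {g \<in> h1_space \<Omega>. \<exists>\<psi> :: nat \<Rightarrow> 'a \<Rightarrow> real.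
     (\<forall>k. test_function \<Omega> (\<psi> k)) \<and> (\<lambda>k. h1_norm \<Omega> (\<lambda>x. \<psi> k x - g x)) \<longlonglongrightarrow> 0}"

definition h10_inner :: "'a::euclidean_space set \<Rightarrow> ('a \<Rightarrow> real) \<Rightarrow> ('a \<Rightarrow> real) \<Rightarrow> real" where
  "h10_inner \<Omega> g h = l2_inner \<Omega> (wgrad \<Omega> g) (wgrad \<Omega> h)"

text \<open>Below, an inner product \<open>ip\<close> (\<open>l2_inner \<Omega>\<close> or \<open>h10_inner \<Omega>\<close>) stands for the space it
  belongs to.\<close>

definition ip_norm :: "(('a \<Rightarrow> real) \<Rightarrow> ('a \<Rightarrow> real) \<Rightarrow> real) \<Rightarrow> ('a \<Rightarrow> real) \<Rightarrow> real" where
  "ip_norm ip g = sqrt (ip g g)"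

text \<open>A representative of the \<open>ip\<close>-orthogonal projection of \<open>g\<close> onto \<open>W\<close>.\<close>

definition orth_proj ::
    "(('a \<Rightarrow> real) \<Rightarrow> ('a \<Rightarrow> real) \<Rightarrow> real) \<Rightarrow> ('a \<Rightarrow> real) set \<Rightarrow> ('a \<Rightarrow> real) \<Rightarrow> 'a \<Rightarrow> real" where
  "orth_proj ip W g = (SOME w. w \<in> W \<and> (\<forall>v\<in>W. ip (\<lambda>x. g x - w x) v = 0))"

text \<open>All square integrable functions that are almost everywhere equal to a linear combination
  of the finite set \<open>B\<close>.\<close>

definition l2_span :: "'a::euclidean_space set \<Rightarrow> ('a \<Rightarrow> real) set \<Rightarrow> ('a \<Rightarrow> real) set" where
  "l2_span \<Omega> B = {g \<in> l2_space \<Omega>. \<exists>c. ae_eq \<Omega> g (\<lambda>x. \<Sum>b\<in>B. c b * b x)}"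

text \<open>A conforming finite element space enters only as a finite-dimensional subspace of
  \<open>H\<^sup>1\<^sub>0(\<Omega>)\<close>.\<close>

definition conforming_space :: "'a::euclidean_space set \<Rightarrow> ('a \<Rightarrow> real) set \<Rightarrow> bool" where
  "conforming_space \<Omega> W \<longleftrightarrow> (\<exists>B. finite B \<and> B \<subseteq> h10_space \<Omega> \<and> W = l2_span \<Omega> B)"


section \<open>Finite element solution, POD and BE-POD-ROM\<close>

text \<open>Everything that depends on the discretization: the space \<open>V\<^sup>h\<close>, the number \<open>N\<close> of time
  levels, the finite element solution \<open>u\<^sup>n\<close>, the POD eigenvalues \<open>\<lambda>\<^sub>i\<close>, the singular vectors
  \<open>f\<^sub>i \<in> S\<close> and \<open>\<phi>\<^sub>i \<in> L\<^sup>2(\<Omega>)\<close>, the number \<open>r\<close> of modes, and the ROM solution \<open>u\<^sub>r\<^sup>n\<close>. All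
  indices start at 1; values at index 0 are irrelevant. The time levels are \<open>n = 1, ..., N\<close>, and
  a vector of \<open>S\<close> is a function on these.\<close>

record 'a rom_disc =
  fe_space :: "('a \<Rightarrow> real) set"
  levels :: nat
  fe_sol :: "nat \<Rightarrow> 'a \<Rightarrow> real"
  pod_eval :: "nat \<Rightarrow> real"
  pod_coeff :: "nat \<Rightarrow> nat \<Rightarrow> real"
  pod_mode :: "nat \<Rightarrow> 'a \<Rightarrow> real"
  rom_dim :: nat
  rom_sol :: "nat \<Rightarrow> 'a \<Rightarrow> real"

definition time_step :: "real \<Rightarrow> 'a rom_disc \<Rightarrow> real" where
  "time_step T d = T / (real (levels d) - 1)"

definition time_level :: "real \<Rightarrow> 'a rom_disc \<Rightarrow> nat \<Rightarrow> real" where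
  "time_level T d n = (real n - 1) * time_step T d"

definition diff_quot :: "real \<Rightarrow> 'a rom_disc \<Rightarrow> (nat \<Rightarrow> 'a \<Rightarrow> real) \<Rightarrow> nat \<Rightarrow> 'a \<Rightarrow> real" where
  "diff_quot T d z n x = (z (Suc n) x - z n x) / time_step T d"

definition backward_euler ::
    "'a::euclidean_space set \<Rightarrow> real \<Rightarrow> real \<Rightarrow> (real \<Rightarrow> 'a \<Rightarrow> real) \<Rightarrow> 'a rom_disc \<Rightarrow>
     ('a \<Rightarrow> real) set \<Rightarrow> (nat \<Rightarrow> 'a \<Rightarrow> real) \<Rightarrow> bool" where
  "backward_euler \<Omega> \<nu> T f d W z \<longleftrightarrow>
     (\<forall>n\<in>{1..levels d}. z n \<in> W) \<and>
     (\<forall>n\<in>{1..levels d - 1}. \<forall>v\<in>W.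
        l2_inner \<Omega> (diff_quot T d z n) v + \<nu> * h10_inner \<Omega> (z (Suc n)) v
          = l2_inner \<Omega> (f (time_level T d (Suc n))) v)"

definition s_inner :: "real \<Rightarrow> 'a rom_disc \<Rightarrow> (nat \<Rightarrow> real) \<Rightarrow> (nat \<Rightarrow> real) \<Rightarrow> real" where
  "s_inner T d g h = g 1 * h 1 + time_step T d * (\<Sum>j=2..levels d. g j * h j)"

definition pod_op :: "real \<Rightarrow> 'a rom_disc \<Rightarrow> (nat \<Rightarrow> real) \<Rightarrow> 'a \<Rightarrow> real" where
  "pod_op T d g x = g 1 * fe_sol d 1 x +
     (\<Sum>j=1..levels d - 1. time_step T d * g (Suc j) * diff_quot T d (fe_sol d) j x)"

text \<open>The singular value decomposition of \<open>pod_op\<close>, with POD space \<open>L\<^sup>2(\<Omega>)\<close>. Since \<open>S\<close> has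
  dimension \<open>N\<close>, there are \<open>N\<close> right singular vectors, which form an orthonormal basis of \<open>S\<close>. The
  POD modes are an orthonormal sequence and the POD eigenvalues vanish from index \<open>N + 1\<close> on.\<close>

definition pod_svd :: "'a::euclidean_space set \<Rightarrow> real \<Rightarrow> 'a rom_disc \<Rightarrow> bool" where
  "pod_svd \<Omega> T d \<longleftrightarrow>
     (\<forall>i\<ge>1. 0 \<le> pod_eval d i) \<and>
     (\<forall>i\<ge>1. \<forall>j\<ge>i. pod_eval d j \<le> pod_eval d i) \<and>
     (\<forall>i>levels d. pod_eval d i = 0) \<and>
     (\<forall>i\<in>{1..levels d}. \<forall>j\<in>{1..levels d}.
        s_inner T d (pod_coeff d i) (pod_coeff d j) = (if i = j then 1 else 0)) \<and>
     (\<forall>i\<ge>1. pod_mode d i \<in> l2_space \<Omega>) \<and>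
     (\<forall>i\<ge>1. \<forall>j\<ge>1. l2_inner \<Omega> (pod_mode d i) (pod_mode d j) = (if i = j then 1 else 0)) \<and>
     (\<forall>i\<in>{1..levels d}.
        ae_eq \<Omega> (pod_op T d (pod_coeff d i)) (\<lambda>x. sqrt (pod_eval d i) * pod_mode d i x))"

definition pod_rank :: "'a rom_disc \<Rightarrow> nat" where
  "pod_rank d = card {i. 1 \<le> i \<and> 0 < pod_eval d i}"

definition rom_space :: "'a::euclidean_space set \<Rightarrow> 'a rom_disc \<Rightarrow> ('a \<Rightarrow> real) set" where
  "rom_space \<Omega> d = l2_span \<Omega> (pod_mode d ` {1..rom_dim d})"

text \<open>The setting: a finite element solution, its POD, and the BE-POD-ROM started from the
  \<open>L\<^sup>2\<close>-projection of the initial condition \<open>u\<^sup>1 \<in> V\<^sup>h\<close>.\<close>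

definition be_pod_rom ::
    "'a::euclidean_space set \<Rightarrow> real \<Rightarrow> real \<Rightarrow> (real \<Rightarrow> 'a \<Rightarrow> real) \<Rightarrow> 'a rom_disc \<Rightarrow> bool" where
  "be_pod_rom \<Omega> \<nu> T f d \<longleftrightarrow>
     conforming_space \<Omega> (fe_space d) \<and> 2 \<le> levels d \<and>
     backward_euler \<Omega> \<nu> T f d (fe_space d) (fe_sol d) \<and>
     pod_svd \<Omega> T d \<and>
     1 \<le> rom_dim d \<and> (\<forall>i\<in>{1..rom_dim d}. pod_mode d i \<in> fe_space d) \<and>
     backward_euler \<Omega> \<nu> T f d (rom_space \<Omega> d) (rom_sol d) \<and>
     ae_eq \<Omega> (rom_sol d 1) (orth_proj (l2_inner \<Omega>) (rom_space \<Omega> d) (fe_sol d 1))"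

definition ritz :: "'a::euclidean_space set \<Rightarrow> 'a rom_disc \<Rightarrow> ('a \<Rightarrow> real) \<Rightarrow> 'a \<Rightarrow> real" where
  "ritz \<Omega> d w = orth_proj (h10_inner \<Omega>) (rom_space \<Omega> d) w"

text \<open>\<open>\<phi>\<^sub>i - R\<^sub>r \<phi>\<^sub>i\<close> for the POD mode \<open>\<phi>\<^sub>i\<close>, and \<open>u\<^sub>r\<^sup>n - R\<^sub>r u\<^sup>n\<close>.\<close>

definition ritz_mode_error :: "'a::euclidean_space set \<Rightarrow> 'a rom_disc \<Rightarrow> nat \<Rightarrow> 'a \<Rightarrow> real" where
  "ritz_mode_error \<Omega> d i x = pod_mode d i x - ritz \<Omega> d (pod_mode d i) x"

definition discrete_rom_error :: "'a::euclidean_space set \<Rightarrow> 'a rom_disc \<Rightarrow> nat \<Rightarrow> 'a \<Rightarrow> real" where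
  "discrete_rom_error \<Omega> d n x = rom_sol d n x - ritz \<Omega> d (fe_sol d n) x"

text \<open>The ROM discretization error and the one for the initial condition, for the error norm
  spaces \<open>L\<^sup>2(\<Omega>)\<close> and \<open>H\<^sup>1\<^sub>0(\<Omega>)\<close>.\<close>

definition disc_error_L2 :: "'a::euclidean_space set \<Rightarrow> 'a rom_disc \<Rightarrow> real" where
  "disc_error_L2 \<Omega> d =
     (\<Sum>i=rom_dim d + 1..pod_rank d.
        pod_eval d i * (ip_norm (l2_inner \<Omega>) (ritz_mode_error \<Omega> d i))\<^sup>2)"

definition init_error_L2 :: "'a::euclidean_space set \<Rightarrow> 'a rom_disc \<Rightarrow> real" where
  "init_error_L2 \<Omega> d = (ip_norm (l2_inner \<Omega>) (discrete_rom_error \<Omega> d 1))\<^sup>2"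

definition disc_error_H10 :: "'a::euclidean_space set \<Rightarrow> 'a rom_disc \<Rightarrow> real" where
  "disc_error_H10 \<Omega> d =
     (\<Sum>i=rom_dim d + 1..pod_rank d.
        pod_eval d i * ((ip_norm (l2_inner \<Omega>) (ritz_mode_error \<Omega> d i))\<^sup>2 +
                        (ip_norm (h10_inner \<Omega>) (ritz_mode_error \<Omega> d i))\<^sup>2))"

definition init_error_H10 :: "'a::euclidean_space set \<Rightarrow> 'a rom_disc \<Rightarrow> real" where
  "init_error_H10 \<Omega> d = (ip_norm (h10_inner \<Omega>) (discrete_rom_error \<Omega> d 1))\<^sup>2"


section \<open>Optimality\<close>

text \<open>Independence of the constants from the discretization parameters is uniformity over a set
  \<open>D\<close> of discretizations of one fixed problem. \<open>D\<close> may be any such set, in particular the set of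
  all admissible ones. The argument \<open>Y\<close> is the inner product of the error norm space; \<open>\<Lambda>\<close> and
  \<open>\<Lambda>1\<close> are the ROM discretization error and the one for the initial condition. The pointwise
  bound of the ROM error in which they occur is not part of the definitions.\<close>

definition optimal_I ::
    "(('a \<Rightarrow> real) \<Rightarrow> ('a \<Rightarrow> real) \<Rightarrow> real) \<Rightarrow> 'a rom_disc set \<Rightarrow>
     ('a rom_disc \<Rightarrow> real) \<Rightarrow> ('a rom_disc \<Rightarrow> real) \<Rightarrow> bool" where
  "optimal_I Y D \<Lambda> \<Lambda>1 \<longleftrightarrow>
     (\<exists>C. \<forall>d\<in>D. \<Lambda> d + \<Lambda>1 d \<le>
        C * (\<Sum>i=rom_dim d + 1..pod_rank d. pod_eval d i * (ip_norm Y (pod_mode d i))\<^sup>2))"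

definition optimal_II ::
    "'a::euclidean_space set \<Rightarrow> (('a \<Rightarrow> real) \<Rightarrow> ('a \<Rightarrow> real) \<Rightarrow> real) \<Rightarrow> 'a rom_disc set \<Rightarrow>
     ('a rom_disc \<Rightarrow> real) \<Rightarrow> ('a rom_disc \<Rightarrow> real) \<Rightarrow> bool" where
  "optimal_II \<Omega> Y D \<Lambda> \<Lambda>1 \<longleftrightarrow>
     (\<exists>C. \<forall>d\<in>D. \<Lambda> d + \<Lambda>1 d \<le>
        C * (\<Sum>i=rom_dim d + 1..pod_rank d. pod_eval d i *
               (ip_norm Y (\<lambda>x. pod_mode d i x - orth_proj Y (rom_space \<Omega> d) (pod_mode d i) x))\<^sup>2))"

end

theory Submission
  imports Defs
begin

text \<open>
  The heart of the matter is an exact formula for the initial error. The data contain the initial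
  condition itself, \<open>u\<^sup>1 = K e\<close> with \<open>e = (1, 0, ..., 0) \<in> S\<close>, and \<open>e\<close> is a unit vector of \<open>S\<close>.
  Expanding it in the right singular vectors \<open>f\<^sub>i\<close>, a complete orthonormal system of \<open>S\<close>, gives
  \<open>u\<^sup>1 = \<Sum>i. c\<^sub>i \<sqrt>\<lambda>\<^sub>i \<phi>\<^sub>i\<close> with \<open>\<Sum>i. c\<^sub>i\<^sup>2 = 1\<close> (\<open>initial_condition_modes\<close>). The \<open>L\<^sup>2\<close>-projection
  onto the ROM space fixes \<open>\<phi>\<^sub>i\<close> for \<open>i \<le> r\<close> and annihilates it for \<open>i > r\<close>, because the modes are
  \<open>L\<^sup>2\<close>-orthonormal, while the Ritz projection fixes \<open>\<phi>\<^sub>i\<close> for \<open>i \<le> r\<close>. Hence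
  \<open>u\<^sub>r\<^sup>1 - R\<^sub>r u\<^sup>1 = - (\<Sum>i>r. c\<^sub>i \<sqrt>\<lambda>\<^sub>i R\<^sub>r \<phi>\<^sub>i)\<close> (\<open>projection_difference_null\<close>), and the Cauchy-Schwarz
  inequality bounds its squared norm, in either space, by \<open>\<Sum>i>r. \<lambda>\<^sub>i \<parallel>R\<^sub>r \<phi>\<^sub>i\<parallel>\<^sup>2\<close> (\<open>init_error_bound\<close>).

  What remains is one estimate for each mode with \<open>i > r\<close>. In \<open>L\<^sup>2\<close>, orthogonality of \<open>\<phi>\<^sub>i\<close> to the
  ROM space yields \<open>\<parallel>\<phi>\<^sub>i - R\<^sub>r \<phi>\<^sub>i\<parallel>\<^sup>2 = 1 + \<parallel>R\<^sub>r \<phi>\<^sub>i\<parallel>\<^sup>2\<close>, so that the assumed bound \<open>C\<^sub>0\<close> controls both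
  contributions and \<open>2 C\<^sub>0\<^sup>2\<close> is a suitable constant. The same orthogonality gives
  \<open>\<parallel>\<phi>\<^sub>i - \<Pi>\<^sub>r \<phi>\<^sub>i\<parallel> = \<parallel>\<phi>\<^sub>i\<parallel>\<close>, so that the right-hand sides of optimal-I and optimal-II coincide. In
  \<open>H\<^sup>1\<^sub>0\<close>, the Ritz projection is orthogonal and splits \<open>\<parallel>\<nabla>\<phi>\<^sub>i\<parallel>\<^sup>2\<close> by Pythagoras; the \<open>L\<^sup>2\<close> part of the
  discretization error is absorbed by the Poincare inequality, whose constant depends only on \<open>\<Omega>\<close>.

  The function spaces have to be made usable first. All functions are representatives of
  equivalence classes, and the weak gradient is an arbitrary choice among almost everywhere equal
  ones; that \<open>(\<nabla>g, \<nabla>h)\<close> is bilinear at all rests on the uniqueness of weak gradients, hence on the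
  fundamental lemma of the calculus of variations and on the existence of enough test functions.
  Null functions are handled by working with positive semidefinite forms instead of quotient spaces;
  the Poincare inequality ensures that \<open>L\<^sup>2\<close> and \<open>H\<^sup>1\<^sub>0\<close> have the same null functions.
\<close>

section \<open>Positive semidefinite forms on spaces of functions\<close>

text \<open>Functions stand for their classes modulo equality almost everywhere, so the inner products of
  \<open>L\<^sup>2\<close> and \<open>H\<^sup>1\<^sub>0\<close> vanish on some nonzero functions. Semidefiniteness is all that survives, and it is
  enough: null functions are orthogonal to everything, and orthogonal projections still exist,
  though only up to null functions.\<close>

locale semi_inner =
  fixes V :: "('a \<Rightarrow> real) set" and ip :: "('a \<Rightarrow> real) \<Rightarrow> ('a \<Rightarrow> real) \<Rightarrow> real"
  assumes zero: "(\<lambda>x. 0) \<in> V"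
    and add: "\<And>g h. g \<in> V \<Longrightarrow> h \<in> V \<Longrightarrow> (\<lambda>x. g x + h x) \<in> V"
    and scale: "\<And>g c. g \<in> V \<Longrightarrow> (\<lambda>x. c * g x) \<in> V"
    and ip_add: "\<And>g h k. g \<in> V \<Longrightarrow> h \<in> V \<Longrightarrow> k \<in> V \<Longrightarrow> ip (\<lambda>x. g x + h x) k = ip g k + ip h k"
    and ip_scale: "\<And>g k c. g \<in> V \<Longrightarrow> k \<in> V \<Longrightarrow> ip (\<lambda>x. c * g x) k = c * ip g k"
    and ip_commute: "\<And>g h. g \<in> V \<Longrightarrow> h \<in> V \<Longrightarrow> ip g h = ip h g"
    and ip_nonneg: "\<And>g. g \<in> V \<Longrightarrow> 0 \<le> ip g g"
begin

lemma diff: "g \<in> V \<Longrightarrow> h \<in> V \<Longrightarrow> (\<lambda>x. g x - h x) \<in> V"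
  using add[of g "\<lambda>x. (-1) * h x"] scale[of h "-1"] by simp

lemma ip_add_right: "g \<in> V \<Longrightarrow> h \<in> V \<Longrightarrow> k \<in> V \<Longrightarrow> ip k (\<lambda>x. g x + h x) = ip k g + ip k h"
  using ip_commute[of k] ip_add add by simp

lemma ip_scale_right: "g \<in> V \<Longrightarrow> k \<in> V \<Longrightarrow> ip k (\<lambda>x. c * g x) = c * ip k g"
  using ip_commute[of k] ip_scale scale by simp

lemma ip_diff: "g \<in> V \<Longrightarrow> h \<in> V \<Longrightarrow> k \<in> V \<Longrightarrow> ip (\<lambda>x. g x - h x) k = ip g k - ip h k"
  using ip_add[of g "\<lambda>x. (-1) * h x"] scale[of h "-1"] ip_scale[of h k "-1"] by simp

lemma ip_diff_right: "g \<in> V \<Longrightarrow> h \<in> V \<Longrightarrow> k \<in> V \<Longrightarrow> ip k (\<lambda>x. g x - h x) = ip k g - ip k h"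
  using ip_commute[of k] ip_diff diff by simp

lemma lincomb:
  assumes "\<And>i. i \<in> I \<Longrightarrow> g i \<in> V"
  shows "(\<lambda>x. \<Sum>i\<in>I. c i * g i x) \<in> V"
  using assms
proof (induction I rule: infinite_finite_induct)
  case (insert i I)
  then show ?case using add[OF scale[of "g i" "c i"]] by simp
qed (simp_all add: zero)

lemma ip_lincomb:
  assumes "\<And>i. i \<in> I \<Longrightarrow> g i \<in> V" and "k \<in> V"
  shows "ip (\<lambda>x. \<Sum>i\<in>I. c i * g i x) k = (\<Sum>i\<in>I. c i * ip (g i) k)"
proof -
  have z: "ip (\<lambda>x. 0) k = 0" using ip_scale[OF zero assms(2), of 0] by simp
  show ?thesis using assms
  proof (induction I rule: infinite_finite_induct)
    case (insert i I)
    then show ?case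
      using ip_add[OF scale[of "g i" "c i"] lincomb[of I g c], of k] ip_scale[of "g i" k "c i"] by simp
  qed (simp_all add: z)
qed

lemma ip_square_add:
  assumes "g \<in> V" "h \<in> V"
  shows "ip (\<lambda>x. g x + t * h x) (\<lambda>x. g x + t * h x) = ip g g + 2 * t * ip g h + t\<^sup>2 * ip h h"
  using assms ip_commute[of h g]
  by (simp add: add scale ip_add ip_add_right ip_scale ip_scale_right algebra_simps power2_eq_square)

lemma Cauchy_Schwarz:
  assumes "g \<in> V" "h \<in> V"
  shows "(ip g h)\<^sup>2 \<le> ip g g * ip h h"
proof -
  have q: "0 \<le> ip g g + 2 * t * ip g h + t\<^sup>2 * ip h h" for t
    using ip_square_add[OF assms, of t] ip_nonneg[OF add[OF assms(1) scale[OF assms(2), of t]]] by simp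
  show ?thesis
  proof (cases "ip h h = 0")
    case True
    have "ip g h = 0"
    proof (rule ccontr)
      assume n: "ip g h \<noteq> 0"
      \<comment> \<open>With \<open>ip h h = 0\<close> the quadratic is affine in \<open>t\<close>; at this \<open>t\<close> it takes the value -1.\<close>
      show False using q[of "- (ip g g + 1) / (2 * ip g h)"] True n by (simp add: field_simps)
    qed
    then show ?thesis using True by simp
  next
    case False
    then have p: "ip h h > 0" using ip_nonneg[OF assms(2)] by simp
    then have "0 \<le> ip g g - (ip g h)\<^sup>2 / ip h h"
      using q[of "- ip g h / ip h h"] by (simp add: field_simps power2_eq_square)
    then show ?thesis using p by (simp add: field_simps)
  qed
qed

lemma ip_null: "g \<in> V \<Longrightarrow> h \<in> V \<Longrightarrow> ip g g = 0 \<Longrightarrow> ip g h = 0"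
  using Cauchy_Schwarz[of g h] by simp

lemma norm_square: "g \<in> V \<Longrightarrow> (ip_norm ip g)\<^sup>2 = ip g g"
  by (simp add: ip_norm_def ip_nonneg)

lemma norm_nonneg: "g \<in> V \<Longrightarrow> 0 \<le> ip_norm ip g"
  by (simp add: ip_norm_def ip_nonneg)

lemma norm_add_le:
  assumes "g \<in> V" "h \<in> V"
  shows "ip_norm ip (\<lambda>x. g x + h x) \<le> ip_norm ip g + ip_norm ip h"
proof -
  have "ip g h \<le> ip_norm ip g * ip_norm ip h"
    using Cauchy_Schwarz[OF assms] norm_square assms norm_nonneg
    by (metis abs_le_square_iff abs_of_nonneg mult_nonneg_nonneg power_mult_distrib abs_le_D1)
  then have "(ip_norm ip (\<lambda>x. g x + h x))\<^sup>2 \<le> (ip_norm ip g + ip_norm ip h)\<^sup>2"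
    using ip_square_add[OF assms, of 1] assms by (simp add: norm_square add power2_sum)
  then show ?thesis using norm_nonneg assms by (meson add_nonneg_nonneg power2_le_imp_le)
qed

lemma norm_scale: "g \<in> V \<Longrightarrow> ip_norm ip (\<lambda>x. c * g x) = \<bar>c\<bar> * ip_norm ip g"
  using scale[of g c] by (simp add: ip_norm_def ip_scale ip_scale_right real_sqrt_mult flip: mult.assoc)

lemma norm_lincomb_le:
  assumes "\<And>i. i \<in> I \<Longrightarrow> g i \<in> V"
  shows "ip_norm ip (\<lambda>x. \<Sum>i\<in>I. c i * g i x) \<le> (\<Sum>i\<in>I. \<bar>c i\<bar> * ip_norm ip (g i))"
proof -
  have z: "ip_norm ip (\<lambda>x. 0) = 0" using norm_scale[OF zero, of 0] by simp
  show ?thesis using assms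
  proof (induction I rule: infinite_finite_induct)
    case (insert i I)
    then show ?case
      using norm_add_le[OF scale[of "g i" "c i"] lincomb[of I g c]] norm_scale[of "g i" "c i"] by force
  qed (simp_all add: z)
qed

text \<open>This is how \<open>\<parallel>\<Sum>i. c\<^sub>i \<sqrt>\<lambda>\<^sub>i R\<^sub>r \<phi>\<^sub>i\<parallel>\<^sup>2\<close> is estimated when nothing is known about the mutual
  orthogonality of the functions \<open>R\<^sub>r \<phi>\<^sub>i\<close>.\<close>

lemma weighted_lincomb_le:
  assumes "\<And>i. i \<in> I \<Longrightarrow> g i \<in> V"
  shows "(ip_norm ip (\<lambda>x. \<Sum>i\<in>I. (c i * s i) * g i x))\<^sup>2
          \<le> (\<Sum>i\<in>I. (c i)\<^sup>2) * (\<Sum>i\<in>I. (s i)\<^sup>2 * ip (g i) (g i))"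
proof -
  have "(ip_norm ip (\<lambda>x. \<Sum>i\<in>I. (c i * s i) * g i x))\<^sup>2 \<le> (\<Sum>i\<in>I. \<bar>c i * s i\<bar> * ip_norm ip (g i))\<^sup>2"
    using norm_lincomb_le[OF assms, where c="\<lambda>i. c i * s i"] norm_nonneg[OF lincomb[OF assms]]
    by (intro power_mono) auto
  also have "\<dots> = (\<Sum>i\<in>I. \<bar>c i\<bar> * (\<bar>s i\<bar> * ip_norm ip (g i)))\<^sup>2"
    by (simp add: abs_mult mult.assoc)
  also have "\<dots> \<le> (\<Sum>i\<in>I. \<bar>c i\<bar>\<^sup>2) * (\<Sum>i\<in>I. (\<bar>s i\<bar> * ip_norm ip (g i))\<^sup>2)"
    by (rule Cauchy_Schwarz_ineq_sum)
  also have "\<dots> = (\<Sum>i\<in>I. (c i)\<^sup>2) * (\<Sum>i\<in>I. (s i)\<^sup>2 * ip (g i) (g i))"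
    using assms by (simp add: power_mult_distrib norm_square)
  finally show ?thesis .
qed

text \<open>Gram-Schmidt, one generator at a time. A new generator whose component orthogonal to the earlier
  ones is null contributes nothing, so that linear dependence and null generators do no harm.\<close>

lemma projection_onto_span_exists:
  assumes "finite B" and "B \<subseteq> V" and "g \<in> V"
  shows "\<exists>c. \<forall>b\<in>B. ip (\<lambda>x. g x - (\<Sum>b'\<in>B. c b' * b' x)) b = 0"
  using assms
proof (induction B arbitrary: g rule: finite_induct)
  case (insert b B)
  note span = lincomb[of B "\<lambda>b. b"]
  from insert obtain p where p: "\<forall>b'\<in>B. ip (\<lambda>x. b x - (\<Sum>b'\<in>B. p b' * b' x)) b' = 0" by blast
  from insert obtain c where c: "\<forall>b'\<in>B. ip (\<lambda>x. g x - (\<Sum>b'\<in>B. c b' * b' x)) b' = 0" by blast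
  define P where "P = (\<lambda>x. \<Sum>b'\<in>B. p b' * b' x)"
  define w where "w = (\<lambda>x. \<Sum>b'\<in>B. c b' * b' x)"
  \<comment> \<open>The component of \<open>b\<close> orthogonal to the earlier generators. The projection is corrected by its
    multiple \<open>t e\<close>, rewritten in terms of the generators by the coefficients \<open>c'\<close>.\<close>
  define e where "e = (\<lambda>x. b x - P x)"
  have V: "P \<in> V" "w \<in> V" "b \<in> V" "B \<subseteq> V" "g \<in> V"
    unfolding P_def w_def using insert by (auto intro: span)
  then have e: "e \<in> V" unfolding e_def by (intro diff)
  have eB: "ip e b' = 0" if "b' \<in> B" for b' using p that by (simp add: e_def P_def)
  have wB: "ip (\<lambda>x. g x - w x) b' = 0" if "b' \<in> B" for b' using c that by (simp add: w_def)
  have eP: "ip e P = 0"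
    using ip_commute[OF e V(1)] ip_lincomb[of B "\<lambda>b. b" e p] eB e V(4) ip_commute unfolding P_def
    by (simp add: subset_iff)
  define t where "t = (if ip e e = 0 then 0 else ip (\<lambda>x. g x - w x) e / ip e e)"
  define c' where "c' = (\<lambda>b'. if b' = b then t else c b' - t * p b')"
  have eq: "(\<Sum>b'\<in>insert b B. c' b' * b' x) = w x + t * e x" for x
  proof -
    have "(\<Sum>b'\<in>B. c' b' * b' x) = (\<Sum>b'\<in>B. (c b' - t * p b') * b' x)"
      using insert.hyps by (intro sum.cong) (auto simp: c'_def)
    then show ?thesis using insert.hyps
      by (simp add: c'_def w_def e_def P_def algebra_simps sum_subtractf sum_distrib_left)
  qed
  let ?h = "\<lambda>x. g x - (\<Sum>b'\<in>insert b B. c' b' * b' x)"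
  have h: "?h = (\<lambda>x. (g x - w x) - t * e x)" by (subst eq) (simp add: algebra_simps)
  have ge: "(\<lambda>x. g x - w x) \<in> V" using V by (intro diff)
  have hip: "ip ?h v = ip (\<lambda>x. g x - w x) v - t * ip e v" if "v \<in> V" for v
    unfolding h using that ge e ip_diff[OF ge scale[OF e, of t], of v] ip_scale[OF e, of v t] by simp
  have hB: "ip ?h b' = 0" if "b' \<in> B" for b'
    using hip[of b'] that V(4) eB wB by auto
  have hV: "?h \<in> V" unfolding h using ge e scale diff by simp
  have he: "ip ?h e = 0"
    using hip[OF e] ip_null[OF e ge] ip_commute[OF e ge] by (simp add: t_def)
  have hP: "ip ?h P = 0"
    using ip_commute[OF hV V(1)] ip_lincomb[of B "\<lambda>b. b" ?h p] hB hV V(4) ip_commute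
    unfolding P_def by (simp add: subset_iff)
  have "ip ?h (\<lambda>x. P x + e x) = 0" using ip_add_right[OF V(1) e hV] he hP by simp
  then have "ip ?h b = 0" by (simp add: e_def)
  with hB show ?case by blast
qed simp

lemma norm_null_perturbation:
  assumes "g \<in> V" "h \<in> V" "ip (\<lambda>x. g x + h x) (\<lambda>x. g x + h x) = 0"
  shows "ip_norm ip g \<le> ip_norm ip h"
proof -
  have "ip_norm ip (\<lambda>x. (g x + h x) + (-1) * h x) \<le> ip_norm ip (\<lambda>x. g x + h x) + ip_norm ip (\<lambda>x. (-1) * h x)"
    by (intro norm_add_le add scale assms)
  then show ?thesis using norm_scale[OF assms(2), of "-1"] assms(3) by (simp add: ip_norm_def)
qed

lemma subspace:
  assumes "W \<subseteq> V" and "(\<lambda>x. 0) \<in> W"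
    and "\<And>g h. g \<in> W \<Longrightarrow> h \<in> W \<Longrightarrow> (\<lambda>x. g x + h x) \<in> W"
    and "\<And>g c. g \<in> W \<Longrightarrow> (\<lambda>x. c * g x) \<in> W"
  shows "semi_inner W ip"
proof
  fix g h k :: "'a \<Rightarrow> real" and c :: real
  have V: "g \<in> W \<Longrightarrow> g \<in> V" for g using assms(1) by blast
  show "g \<in> W \<Longrightarrow> h \<in> W \<Longrightarrow> ip g h = ip h g" by (intro ip_commute V)
  show "g \<in> W \<Longrightarrow> h \<in> W \<Longrightarrow> k \<in> W \<Longrightarrow> ip (\<lambda>x. g x + h x) k = ip g k + ip h k"
    by (intro ip_add V)
  show "g \<in> W \<Longrightarrow> k \<in> W \<Longrightarrow> ip (\<lambda>x. c * g x) k = c * ip g k" by (intro ip_scale V)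
  show "g \<in> W \<Longrightarrow> 0 \<le> ip g g" by (intro ip_nonneg V)
qed (fact assms)+

text \<open>The space \<open>W\<close> may be larger than the span of \<open>B\<close>: it also contains everything that differs from
  the span by a null function, as do spaces closed under equality almost everywhere.\<close>

lemma orth_proj_works:
  assumes sub: "semi_inner W ip" "W \<subseteq> V" and B: "finite B" "B \<subseteq> W"
    and span: "\<And>v. v \<in> W \<Longrightarrow> \<exists>c. let n = (\<lambda>x. v x - (\<Sum>b\<in>B. c b * b x)) in ip n n = 0"
    and g: "g \<in> V"
  shows "orth_proj ip W g \<in> W" and "\<And>v. v \<in> W \<Longrightarrow> ip (\<lambda>x. g x - orth_proj ip W g x) v = 0"
proof -
  interpret W: semi_inner W ip by (rule sub)
  obtain c where c: "\<forall>b\<in>B. ip (\<lambda>x. g x - (\<Sum>b'\<in>B. c b' * b' x)) b = 0"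
    using projection_onto_span_exists[OF B(1) _ g] B(2) sub(2) by blast
  define w where "w = (\<lambda>x. \<Sum>b\<in>B. c b * b x)"
  have w: "w \<in> W" unfolding w_def using B(2) by (intro W.lincomb[of B "\<lambda>b. b"]) auto
  define h where "h = (\<lambda>x. g x - w x)"
  have h: "h \<in> V" unfolding h_def using g w sub(2) by (intro diff) auto
  have "ip h v = 0" if v: "v \<in> W" for v
  proof -
    obtain a where a: "let n = (\<lambda>x. v x - (\<Sum>b\<in>B. a b * b x)) in ip n n = 0" using span[OF v] by blast
    define q where "q = (\<lambda>x. \<Sum>b\<in>B. a b * b x)"
    define n where "n = (\<lambda>x. v x - q x)"
    have q: "q \<in> V" unfolding q_def using B(2) sub(2) by (intro lincomb[of B "\<lambda>b. b"]) auto
    have "v \<in> V" using v sub(2) by blast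
    then have n: "n \<in> V" unfolding n_def using q by (rule diff)
    have nn: "ip n n = 0" using a unfolding n_def q_def Let_def .
    have "ip q h = (\<Sum>b\<in>B. a b * ip b h)"
      unfolding q_def using B(2) sub(2) h by (intro ip_lincomb[of B "\<lambda>b. b"]) auto
    also have "\<dots> = 0"
    proof (rule sum.neutral, rule ballI)
      fix b assume b: "b \<in> B"
      then have "ip b h = ip h b" using B(2) sub(2) h by (intro ip_commute) auto
      then show "a b * ip b h = 0" using c b by (simp add: h_def w_def)
    qed
    finally have "ip h q = 0" using ip_commute[OF h q] by simp
    moreover have "ip h n = 0" using ip_null[OF n h nn] ip_commute[OF h n] by simp
    ultimately have "ip h (\<lambda>x. q x + n x) = 0" using ip_add_right[OF q n h] by simp
    then show ?thesis by (simp add: n_def)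
  qed
  with w have "\<exists>w. w \<in> W \<and> (\<forall>v\<in>W. ip (\<lambda>x. g x - w x) v = 0)"
    unfolding h_def by (intro exI[of _ w] conjI ballI)
  from someI_ex[OF this] show "orth_proj ip W g \<in> W"
    "\<And>v. v \<in> W \<Longrightarrow> ip (\<lambda>x. g x - orth_proj ip W g x) v = 0"
    unfolding orth_proj_def by (rule conjunct1, rule bspec[OF conjunct2])
qed

lemma Pythagoras:
  assumes "g \<in> V" "w \<in> V" "ip (\<lambda>x. g x - w x) w = 0"
  shows "ip g g = ip (\<lambda>x. g x - w x) (\<lambda>x. g x - w x) + ip w w"
  using assms ip_commute[of w g] by (simp add: ip_diff ip_diff_right diff)

lemma Bessel_identity:
  assumes f: "\<And>i. i \<in> I \<Longrightarrow> f i \<in> V" "finite I"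
    and on: "\<And>i j. i \<in> I \<Longrightarrow> j \<in> I \<Longrightarrow> ip (f i) (f j) = (if i = j then 1 else 0)"
    and g: "g \<in> V"
  defines "p \<equiv> \<lambda>x. \<Sum>i\<in>I. ip g (f i) * f i x"
  shows "ip (\<lambda>x. g x - p x) (\<lambda>x. g x - p x) = ip g g - (\<Sum>i\<in>I. (ip g (f i))\<^sup>2)"
proof -
  have p: "p \<in> V" unfolding p_def using f by (intro lincomb)
  have pk: "ip p k = (\<Sum>i\<in>I. ip g (f i) * ip (f i) k)" if "k \<in> V" for k
    unfolding p_def using f that by (intro ip_lincomb)
  have pf: "ip p (f j) = ip g (f j)" if "j \<in> I" for j
  proof -
    have "ip p (f j) = (\<Sum>i\<in>I. if i = j then ip g (f i) else 0)"
      unfolding pk[OF f(1)[OF that]] using on that by (intro sum.cong) auto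
    then show ?thesis using f(2) that by simp
  qed
  have fp: "ip (f i) p = ip g (f i)" if "i \<in> I" for i
    using pf[OF that] ip_commute[OF f(1)[OF that] p] by simp
  have pp: "ip p p = (\<Sum>i\<in>I. (ip g (f i))\<^sup>2)"
    using pk[OF p] fp by (simp add: power2_eq_square)
  have pg: "ip p g = (\<Sum>i\<in>I. (ip g (f i))\<^sup>2)"
    using pk[OF g] ip_commute[OF g f(1)] by (simp add: power2_eq_square)
  have "ip (\<lambda>x. g x - p x) p = 0"
    using ip_diff[OF g p p] ip_commute[OF g p] pp pg by simp
  from Pythagoras[OF g p this] pp show ?thesis by simp
qed

end

section \<open>Orthonormal bases of weighted sequence spaces\<close>

text \<open>As many orthonormal vectors as the dimension form a complete system. This follows without
  dimension theory: Bessel's inequality for the unit vector \<open>e\<^sub>j\<close> reads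
  \<open>\<Sum>i. w\<^sub>j (f\<^sub>i j)\<^sup>2 \<le> 1\<close>, and the sum of the left-hand sides over \<open>j\<close> is the number of vectors
  \<open>f\<^sub>i\<close>, since each has norm 1. So equality holds for every \<open>j\<close>, which means that the residual of
  \<open>e\<^sub>j\<close> is zero.\<close>

lemma orthonormal_basis_complete:
  fixes w :: "'i \<Rightarrow> real" and f :: "'j \<Rightarrow> 'i \<Rightarrow> real"
  assumes fin: "finite I" "finite J" "card I = card J" and w: "\<And>k. k \<in> I \<Longrightarrow> 0 < w k"
    and on: "\<And>i j. i \<in> J \<Longrightarrow> j \<in> J \<Longrightarrow> (\<Sum>k\<in>I. w k * f i k * f j k) = (if i = j then 1 else 0)"
    and j: "j \<in> I"
  shows "k \<in> I \<Longrightarrow> (\<Sum>i\<in>J. w j * f i j * f i k) = (if k = j then 1 else 0)"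
    and "(\<Sum>i\<in>J. w j * (f i j)\<^sup>2) = 1"
proof -
  define ip where "ip = (\<lambda>g h. \<Sum>k\<in>I. w k * g k * h k)"
  interpret semi_inner "UNIV :: ('i \<Rightarrow> real) set" ip
  proof
    fix g h k :: "'i \<Rightarrow> real" and c :: real
    show "ip (\<lambda>x. g x + h x) k = ip g k + ip h k"
      by (simp add: ip_def distrib_left distrib_right sum.distrib)
    show "ip (\<lambda>x. c * g x) k = c * ip g k"
      by (simp add: ip_def sum_distrib_left mult_ac)
    show "ip g h = ip h g" by (simp add: ip_def mult_ac)
    show "0 \<le> ip g g"
      unfolding ip_def mult.assoc
      by (intro sum_nonneg mult_nonneg_nonneg[OF less_imp_le[OF w] zero_le_square])
  qed simp_all
  define e :: "'i \<Rightarrow> 'i \<Rightarrow> real" where "e = (\<lambda>j k. if k = j then 1 else 0)"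
  define p where "p = (\<lambda>j k. \<Sum>i\<in>J. ip (e j) (f i) * f i k)"
  define n where "n = (\<lambda>j k. e j k - p j k)"
  have ef: "ip (e j) g = w j * g j" if "j \<in> I" for j g
  proof -
    have "ip (e j) g = (\<Sum>k\<in>I. if k = j then w k * g k else 0)"
      unfolding ip_def e_def by (intro sum.cong) auto
    then show ?thesis using that fin(1) by simp
  qed
  have res: "ip (n j) (n j) = w j * (1 - (\<Sum>i\<in>J. w j * (f i j)\<^sup>2))" if "j \<in> I" for j
  proof -
    have "ip (n j) (n j) = ip (e j) (e j) - (\<Sum>i\<in>J. (ip (e j) (f i))\<^sup>2)"
      unfolding n_def p_def using fin(2) on by (intro Bessel_identity) (auto simp: ip_def)
    also have "\<dots> = w j - (\<Sum>i\<in>J. (w j * f i j)\<^sup>2)" using ef[OF that] by (simp add: e_def)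
    finally show ?thesis
      by (simp add: algebra_simps sum_distrib_left power2_eq_square)
  qed
  have nonneg: "0 \<le> 1 - (\<Sum>i\<in>J. w j * (f i j)\<^sup>2)" if "j \<in> I" for j
    using res[OF that] ip_nonneg[of "n j"] w[OF that] by (simp add: zero_le_mult_iff)
  have "(\<Sum>j\<in>I. 1 - (\<Sum>i\<in>J. w j * (f i j)\<^sup>2)) = real (card I) - (\<Sum>i\<in>J. \<Sum>j\<in>I. w j * f i j * f i j)"
    unfolding sum_subtractf by (subst sum.swap) (simp add: power2_eq_square mult.assoc)
  also have "\<dots> = 0" using on fin(3) by simp
  finally have "1 - (\<Sum>i\<in>J. w j * (f i j)\<^sup>2) = 0"
    using sum_nonneg_eq_0_iff[OF fin(1) nonneg] j by simp
  then show "(\<Sum>i\<in>J. w j * (f i j)\<^sup>2) = 1" by simp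
  then have "ip (n j) (n j) = 0" using res[OF j] by simp
  then have "(\<Sum>k\<in>I. w k * (n j k * n j k)) = 0" by (simp add: ip_def mult.assoc)
  then have "\<forall>k\<in>I. w k * (n j k * n j k) = 0"
    by (subst (asm) sum_nonneg_eq_0_iff[OF fin(1)])
      (simp_all add: mult_nonneg_nonneg[OF less_imp_le[OF w] zero_le_square])
  then have null: "n j k = 0" if "k \<in> I" for k using w[OF that] that by fastforce
  then show "(\<Sum>i\<in>J. w j * f i j * f i k) = (if k = j then 1 else 0)" if "k \<in> I"
    using null[OF that] unfolding n_def p_def ef[OF j] by (simp add: e_def)
qed

lemma down_closed_eq_atLeastAtMost_card:
  assumes "finite A" "\<And>i. i \<in> A \<Longrightarrow> 1 \<le> i" "\<And>i j. j \<in> A \<Longrightarrow> 1 \<le> i \<Longrightarrow> i \<le> j \<Longrightarrow> i \<in> A"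
  shows "A = {1..card A :: nat}"
proof (cases "A = {}")
  case False
  have "A = {1..Max A}"
  proof (intro equalityI subsetI)
    show "i \<in> {1..Max A}" if "i \<in> A" for i using assms(2)[OF that] Max_ge[OF assms(1) that] by simp
    show "i \<in> A" if "i \<in> {1..Max A}" for i using assms(3)[OF Max_in[OF assms(1) False], of i] that by simp
  qed
  then obtain m where m: "A = {1..m}" ..
  then show ?thesis by simp
qed simp

section \<open>Square integrable functions\<close>

lemma l2_spaceD:
  "g \<in> l2_space \<Omega> \<Longrightarrow> g \<in> borel_measurable (lebesgue_on \<Omega>)"
  "g \<in> l2_space \<Omega> \<Longrightarrow> integrable (lebesgue_on \<Omega>) (\<lambda>x. (norm (g x))\<^sup>2)"
  by (simp_all add: l2_space_def)

lemma l2_integrable_inner: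
  fixes g h :: "'a::euclidean_space \<Rightarrow> 'b::euclidean_space"
  assumes "g \<in> l2_space \<Omega>" "h \<in> l2_space \<Omega>"
  shows "integrable (lebesgue_on \<Omega>) (\<lambda>x. g x \<bullet> h x)"
proof (rule Bochner_Integration.integrable_bound)
  show "integrable (lebesgue_on \<Omega>) (\<lambda>x. (norm (g x))\<^sup>2 + (norm (h x))\<^sup>2)"
    using assms by (intro Bochner_Integration.integrable_add l2_spaceD)
  show "(\<lambda>x. g x \<bullet> h x) \<in> borel_measurable (lebesgue_on \<Omega>)"
    using assms by (intro borel_measurable_inner l2_spaceD)
  have "norm (g x \<bullet> h x) \<le> norm ((norm (g x))\<^sup>2 + (norm (h x))\<^sup>2)" for x
  proof -
    have "2 * (norm (g x) * norm (h x)) \<le> (norm (g x))\<^sup>2 + (norm (h x))\<^sup>2"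
      using sum_squares_bound[of "norm (g x)" "norm (h x)"] by simp
    moreover have "0 \<le> norm (g x) * norm (h x)" by simp
    ultimately show ?thesis using Cauchy_Schwarz_ineq2[of "g x" "h x"] by simp
  qed
  then show "AE x in lebesgue_on \<Omega>. norm (g x \<bullet> h x) \<le> norm ((norm (g x))\<^sup>2 + (norm (h x))\<^sup>2)" by simp
qed

lemma l2_integrable_mult:
  assumes "g \<in> l2_space \<Omega>" "h \<in> l2_space \<Omega>"
  shows "integrable (lebesgue_on \<Omega>) (\<lambda>x. g x * h x :: real)"
  using l2_integrable_inner[OF assms] by (simp add: inner_real_def)

lemma l2_zero: "(\<lambda>x. 0) \<in> l2_space \<Omega>"
  by (simp add: l2_space_def)

lemma l2_add:
  assumes "g \<in> l2_space \<Omega>" "h \<in> l2_space \<Omega>"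
  shows "(\<lambda>x. g x + h x) \<in> l2_space \<Omega>"
proof -
  have "integrable (lebesgue_on \<Omega>) (\<lambda>x. (norm (g x))\<^sup>2 + 2 * (g x \<bullet> h x) + (norm (h x))\<^sup>2)"
    using assms l2_integrable_inner[OF assms]
    by (intro Bochner_Integration.integrable_add integrable_mult_right l2_spaceD) auto
  moreover have "(norm (g x + h x))\<^sup>2 = (norm (g x))\<^sup>2 + 2 * (g x \<bullet> h x) + (norm (h x))\<^sup>2" for x
    by (simp add: power2_norm_eq_inner inner_add inner_commute)
  ultimately show ?thesis using assms by (auto simp: l2_space_def intro!: borel_measurable_add)
qed

lemma l2_scale: "g \<in> l2_space \<Omega> \<Longrightarrow> (\<lambda>x. c *\<^sub>R g x) \<in> l2_space \<Omega>"
  by (auto simp: l2_space_def power_mult_distrib intro!: borel_measurable_scaleR)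

lemma l2_inner_commute: "l2_inner \<Omega> g h = l2_inner \<Omega> h g"
  by (simp add: l2_inner_def inner_commute)

lemma l2_inner_add:
  assumes "g \<in> l2_space \<Omega>" "h \<in> l2_space \<Omega>" "k \<in> l2_space \<Omega>"
  shows "l2_inner \<Omega> (\<lambda>x. g x + h x) k = l2_inner \<Omega> g k + l2_inner \<Omega> h k"
  using assms by (simp add: l2_inner_def inner_add_left l2_integrable_inner)

lemma l2_inner_scale: "l2_inner \<Omega> (\<lambda>x. c *\<^sub>R g x) k = c * l2_inner \<Omega> g k"
  by (simp add: l2_inner_def)

lemma l2_inner_nonneg: "0 \<le> l2_inner \<Omega> g g"
  by (simp add: l2_inner_def)

lemma semi_inner_l2: "semi_inner (l2_space \<Omega>) (l2_inner \<Omega>)"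
  by standard
    (use l2_zero l2_add l2_scale[where 'b=real] l2_inner_add l2_inner_scale[where 'b=real]
      l2_inner_commute l2_inner_nonneg in \<open>auto\<close>)

lemma l2_inner_cong:
  assumes "AE x in lebesgue_on \<Omega>. g x = g' x" "AE x in lebesgue_on \<Omega>. h x = h' x"
    and "g \<in> l2_space \<Omega>" "g' \<in> l2_space \<Omega>" "h \<in> l2_space \<Omega>" "h' \<in> l2_space \<Omega>"
  shows "l2_inner \<Omega> g h = l2_inner \<Omega> g' h'"
  unfolding l2_inner_def
proof (rule integral_cong_AE)
  show "AE x in lebesgue_on \<Omega>. g x \<bullet> h x = g' x \<bullet> h' x"
    using assms(1,2) by eventually_elim simp
qed (use assms l2_spaceD in \<open>auto intro!: borel_measurable_inner\<close>)

lemma l2_null_iff: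
  assumes "g \<in> l2_space \<Omega>"
  shows "l2_inner \<Omega> g g = 0 \<longleftrightarrow> (AE x in lebesgue_on \<Omega>. g x = 0)"
proof -
  have "l2_inner \<Omega> g g = 0 \<longleftrightarrow> (AE x in lebesgue_on \<Omega>. g x \<bullet> g x = 0)"
    unfolding l2_inner_def
    using l2_integrable_inner[OF assms assms] by (intro integral_nonneg_eq_0_iff_AE) auto
  then show ?thesis by simp
qed

section \<open>Test functions\<close>

lemma partial_eqI: "(\<psi> has_derivative D) (at x) \<Longrightarrow> partial b \<psi> x = D b"
  unfolding partial_def using frechet_derivative_at[of \<psi> D x] by simp

lemma partial_const: "partial b (\<lambda>x. c) = (\<lambda>x. 0)"
  by (rule ext, subst partial_eqI[OF has_derivative_const]) simp

lemma partial_add: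
  assumes "\<And>x. \<psi> differentiable (at x)" "\<And>x. \<eta> differentiable (at x)"
  shows "partial b (\<lambda>x. \<psi> x + \<eta> x) = (\<lambda>x. partial b \<psi> x + partial b \<eta> x)"
proof
  fix x
  show "partial b (\<lambda>x. \<psi> x + \<eta> x) x = partial b \<psi> x + partial b \<eta> x"
    using assms[of x] unfolding frechet_derivative_works
    by (subst partial_eqI[OF has_derivative_add]) (auto simp: partial_def)
qed

lemma partial_mult:
  assumes "\<And>x. \<psi> differentiable (at x)" "\<And>x. \<eta> differentiable (at x)"
  shows "partial b (\<lambda>x. \<psi> x * \<eta> x) = (\<lambda>x. \<psi> x * partial b \<eta> x + partial b \<psi> x * \<eta> x)"
proof
  fix x
  show "partial b (\<lambda>x. \<psi> x * \<eta> x) x = \<psi> x * partial b \<eta> x + partial b \<psi> x * \<eta> x"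
    using assms[of x] unfolding frechet_derivative_works
    by (subst partial_eqI[OF has_derivative_mult]) (auto simp: partial_def)
qed

lemma k_smooth_differentiable: "k_smooth (Suc k) \<psi> \<Longrightarrow> \<psi> differentiable (at x)"
  by simp

lemma k_smooth_Suc_imp: "k_smooth (Suc k) \<psi> \<Longrightarrow> k_smooth k \<psi>"
proof (induction k arbitrary: \<psi>)
  case 0
  then show ?case
    by (auto intro!: continuous_at_imp_continuous_on differentiable_imp_continuous_within)
next
  case (Suc k)
  have "k_smooth k (partial b \<psi>)" if "b \<in> Basis" for b
    using Suc.prems that by (intro Suc.IH) simp
  then show ?case using Suc.prems by simp
qed

lemma k_smooth_const: "k_smooth k (\<lambda>x. c)"
  by (induction k arbitrary: c) (simp_all add: partial_const)

lemma k_smooth_add: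
  "k_smooth k \<psi> \<Longrightarrow> k_smooth k \<eta> \<Longrightarrow> k_smooth k (\<lambda>x. \<psi> x + \<eta> x)"
proof (induction k arbitrary: \<psi> \<eta>)
  case 0
  then show ?case by (simp add: continuous_on_add)
next
  case (Suc k)
  then show ?case by (simp add: partial_add differentiable_add)
qed

lemma k_smooth_mult:
  "k_smooth k \<psi> \<Longrightarrow> k_smooth k \<eta> \<Longrightarrow> k_smooth k (\<lambda>x. \<psi> x * \<eta> x)"
proof (induction k arbitrary: \<psi> \<eta>)
  case 0
  then show ?case by (simp add: continuous_on_mult)
next
  case (Suc k)
  have "k_smooth k \<psi>" "k_smooth k \<eta>" using Suc.prems k_smooth_Suc_imp by blast+
  then have "k_smooth k (partial b (\<lambda>x. \<psi> x * \<eta> x))" if "b \<in> Basis" for b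
    using Suc.prems that by (subst partial_mult) (auto intro!: k_smooth_add Suc.IH)
  then show ?case using Suc.prems by (simp add: differentiable_mult)
qed

lemma k_smooth_prod:
  "(\<And>i. i \<in> I \<Longrightarrow> k_smooth k (\<psi> i)) \<Longrightarrow> k_smooth k (\<lambda>x. \<Prod>i\<in>I. \<psi> i x)"
  by (induction I rule: infinite_finite_induct) (simp_all add: k_smooth_const k_smooth_mult)

lemma k_smooth_inner: "k_smooth k (\<lambda>x. x \<bullet> b)"
proof -
  have d: "((\<lambda>x. x \<bullet> b) has_derivative (\<lambda>h. h \<bullet> b)) (at x)" for x
    by (rule has_derivative_inner_left[OF has_derivative_ident])
  have "partial c (\<lambda>x. x \<bullet> b) = (\<lambda>x. c \<bullet> b)" for c
    using partial_eqI[OF d] by auto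
  moreover have "(\<lambda>x. x \<bullet> b) differentiable (at x)" for x using d differentiableI by blast
  ultimately show ?thesis
    by (cases k) (auto simp: k_smooth_const intro!: continuous_intros)
qed

text \<open>The functions \<open>p(1/t) exp(-1/t)\<close>, extended by 0 to \<open>t \<le> 0\<close>. Admitting the polynomial factor makes
  the family closed under differentiation, so that smoothness is a one-step induction.\<close>

definition flat_exp :: "real poly \<Rightarrow> real \<Rightarrow> real" where
  "flat_exp p t = (if t > 0 then poly p (1 / t) * exp (- (1 / t)) else 0)"

lemma poly_times_exp_tendsto_0: "((\<lambda>x. poly p x * exp (- x)) \<longlongrightarrow> 0) (at_top :: real filter)"
proof -
  have "((\<lambda>x. \<Sum>i\<le>degree p. coeff p i * (x ^ i / exp x)) \<longlongrightarrow> (\<Sum>i\<le>degree p. coeff p i * 0)) at_top"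
    by (intro tendsto_sum tendsto_mult tendsto_const tendsto_power_div_exp_0)
  then show ?thesis
    by (simp add: poly_altdef sum_distrib_right exp_minus field_simps sum_divide_distrib)
qed

lemma flat_exp_DERIV:
  "(flat_exp p has_real_derivative flat_exp (monom 1 2 * (p - pderiv p)) t) (at t)"
proof -
  consider "t > 0" | "t < 0" | "t = 0" by linarith
  then show ?thesis
  proof cases
    case 1
    have "((\<lambda>t. poly p (1 / t) * exp (- (1 / t))) has_real_derivative
        flat_exp (monom 1 2 * (p - pderiv p)) t) (at t)"
      using 1
      by (auto intro!: derivative_eq_intros DERIV_chain2[OF poly_DERIV]
               simp: flat_exp_def poly_monom field_simps power2_eq_square)
    then show ?thesis
      by (rule has_field_derivative_transform_within_open[where S="{0<..}"]) (use 1 in \<open>auto simp: flat_exp_def\<close>)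
  next
    case 2
    have "((\<lambda>t. 0) has_real_derivative flat_exp (monom 1 2 * (p - pderiv p)) t) (at t)"
      using 2 by (simp add: flat_exp_def)
    then show ?thesis
      by (rule has_field_derivative_transform_within_open[where S="{..<0}"]) (use 2 in \<open>auto simp: flat_exp_def\<close>)
  next
    case 3
    have "((\<lambda>h. flat_exp p h / h) \<longlongrightarrow> 0) (at_right 0)"
    proof (subst filterlim_at_right_to_top)
      have "((\<lambda>x. poly (monom 1 1 * p) x * exp (- x)) \<longlongrightarrow> 0) at_top"
        by (rule poly_times_exp_tendsto_0)
      then show "((\<lambda>x. flat_exp p (inverse x) / inverse x) \<longlongrightarrow> 0) at_top"
        by (rule Lim_transform_eventually)
          (use eventually_gt_at_top[of 0] in eventually_elim, simp add: flat_exp_def poly_monom field_simps)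
    qed
    moreover have "((\<lambda>h. flat_exp p h / h) \<longlongrightarrow> 0) (at_left 0)"
      by (rule Lim_transform_eventually[OF tendsto_const])
        (auto simp: eventually_at_filter flat_exp_def)
    ultimately have "((\<lambda>h. flat_exp p h / h) \<longlongrightarrow> 0) (at 0)"
      by (intro filterlim_split_at)
    then show ?thesis using 3 by (simp add: DERIV_def flat_exp_def)
  qed
qed

text \<open>These compositions with an affine function of one coordinate are the factors of the bump functions
  on boxes.\<close>

lemma k_smooth_flat_exp: "k_smooth k (\<lambda>x. flat_exp p (a * (x \<bullet> b) + c))"
proof (induction k arbitrary: p)
  case 0
  have "continuous_on UNIV (flat_exp p)"
    by (intro continuous_at_imp_continuous_on ballI DERIV_isCont[OF flat_exp_DERIV])
  then show ?case
    by (auto intro!: continuous_on_compose2[of UNIV "flat_exp p"] continuous_intros)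
next
  case (Suc k)
  let ?q = "monom 1 2 * (p - pderiv p)"
  have d: "((\<lambda>x. flat_exp p (a * (x \<bullet> b) + c)) has_derivative
      (\<lambda>h. flat_exp ?q (a * (x \<bullet> b) + c) * (a * (h \<bullet> b)))) (at x)" for x
  proof -
    have i: "((\<lambda>x. a * (x \<bullet> b) + c) has_derivative (\<lambda>h. a * (h \<bullet> b))) (at x)"
      by (auto intro!: derivative_eq_intros)
    show ?thesis
      using has_derivative_compose[OF i flat_exp_DERIV[of p "a * (x \<bullet> b) + c", unfolded has_field_derivative_def]]
      by simp
  qed
  have "partial b' (\<lambda>x. flat_exp p (a * (x \<bullet> b) + c))
      = (\<lambda>x. flat_exp ?q (a * (x \<bullet> b) + c) * (a * (b' \<bullet> b)))" for b'
    using partial_eqI[OF d] by auto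
  then have "k_smooth k (partial b' (\<lambda>x. flat_exp p (a * (x \<bullet> b) + c)))" for b'
    using k_smooth_mult[OF Suc.IH k_smooth_const] by simp
  then show ?case using d by (auto simp: differentiable_def)
qed

lemma test_functionD:
  assumes "test_function \<Omega> \<psi>"
  shows "\<psi> differentiable (at x)" "k_smooth k \<psi>" "continuous_on UNIV \<psi>"
proof -
  have "k_smooth (Suc 0) \<psi>" "k_smooth 0 \<psi>" "k_smooth k \<psi>" using assms unfolding test_function_def by blast+
  then show "\<psi> differentiable (at x)" "k_smooth k \<psi>" "continuous_on UNIV \<psi>" by auto
qed

lemma test_function_partial:
  assumes "test_function \<Omega> \<psi>" "b \<in> Basis"
  shows "test_function \<Omega> (partial b \<psi>)"
proof -
  obtain K where K: "compact K" "K \<subseteq> \<Omega>" "\<And>x. x \<notin> K \<Longrightarrow> \<psi> x = 0"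
    using assms unfolding test_function_def by blast
  have "partial b \<psi> x = 0" if "x \<notin> K" for x
  proof -
    have "((\<lambda>x. 0) has_derivative (\<lambda>h. 0)) (at x)" by simp
    then have "(\<psi> has_derivative (\<lambda>h. 0)) (at x)"
      by (rule has_derivative_transform_within_open[where s="- K"])
        (use K that in \<open>auto simp: compact_imp_closed\<close>)
    then show ?thesis by (simp add: partial_eqI)
  qed
  moreover have "k_smooth k (partial b \<psi>)" for k
    using test_functionD(2)[OF assms(1), of "Suc k"] assms(2) by simp
  ultimately show ?thesis using K unfolding test_function_def by blast
qed

lemma test_function_mult:
  assumes "test_function \<Omega> \<psi>" "\<And>k. k_smooth k \<eta>"
  shows "test_function \<Omega> (\<lambda>x. \<eta> x * \<psi> x)"
proof -
  obtain K where "compact K" "K \<subseteq> \<Omega>" "\<And>x. x \<notin> K \<Longrightarrow> \<psi> x = 0"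
    using assms unfolding test_function_def by blast
  then show ?thesis using assms unfolding test_function_def
    by (intro conjI allI exI[of _ K]) (auto intro: k_smooth_mult)
qed

lemma test_function_add:
  assumes "test_function \<Omega> \<psi>" "test_function \<Omega> \<eta>"
  shows "test_function \<Omega> (\<lambda>x. \<psi> x + \<eta> x)"
proof -
  obtain K K' where "compact K" "K \<subseteq> \<Omega>" "\<And>x. x \<notin> K \<Longrightarrow> \<psi> x = 0"
    "compact K'" "K' \<subseteq> \<Omega>" "\<And>x. x \<notin> K' \<Longrightarrow> \<eta> x = 0"
    using assms unfolding test_function_def by blast
  then show ?thesis using assms unfolding test_function_def
    by (intro conjI allI exI[of _ "K \<union> K'"]) (auto intro: compact_Un k_smooth_add)
qed

lemma test_function_bounded:
  assumes "test_function \<Omega> \<psi>"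
  obtains M where "\<And>x. \<bar>\<psi> x\<bar> \<le> M"
proof -
  obtain K where K: "compact K" "\<And>x. x \<notin> K \<Longrightarrow> \<psi> x = 0"
    using assms unfolding test_function_def by blast
  have "bounded (\<psi> ` K)"
    using K test_functionD(3)[OF assms]
    by (intro compact_imp_bounded compact_continuous_image) (auto intro: continuous_on_subset)
  then obtain M where M: "\<And>x. x \<in> K \<Longrightarrow> \<bar>\<psi> x\<bar> \<le> M" "M > 0" unfolding bounded_pos by auto
  have "\<bar>\<psi> x\<bar> \<le> M" for x using M K(2)[of x] by (cases "x \<in> K") auto
  then show ?thesis using that by blast
qed

lemma test_function_borel: "test_function \<Omega> \<psi> \<Longrightarrow> \<psi> \<in> borel_measurable borel"
  using test_functionD(3) borel_measurable_continuous_onI by blast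

lemma borel_imp_lebesgue_on:
  assumes "g \<in> borel_measurable borel"
  shows "g \<in> borel_measurable (lebesgue_on \<Omega>)"
  by (rule measurable_restrict_space1) (use assms in \<open>simp add: measurable_completion\<close>)

lemma finite_measure_lebesgue_on_bounded:
  assumes "open \<Omega>" "bounded \<Omega>"
  shows "finite_measure (lebesgue_on \<Omega>)"
  by (rule finite_measure_lebesgue_on) (use assms in \<open>simp add: lmeasurable_open\<close>)

lemma test_function_l2:
  assumes "open \<Omega>" "bounded \<Omega>" "test_function \<Omega> \<psi>"
  shows "\<psi> \<in> l2_space \<Omega>"
proof -
  interpret finite_measure "lebesgue_on \<Omega>"
    using assms finite_measure_lebesgue_on_bounded by blast
  note meas = borel_imp_lebesgue_on[OF test_function_borel[OF assms(3)], of \<Omega>]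
  obtain M where "\<And>x. \<bar>\<psi> x\<bar> \<le> M" using test_function_bounded[OF assms(3)] by blast
  then have "norm ((norm (\<psi> x))\<^sup>2) \<le> M\<^sup>2" for x by (auto simp: power_mono[of "\<bar>\<psi> x\<bar>" M 2, simplified])
  then have "integrable (lebesgue_on \<Omega>) (\<lambda>x. (norm (\<psi> x))\<^sup>2)"
    by (intro integrable_const_bound[where B="M\<^sup>2"] borel_measurable_power borel_measurable_norm meas) (auto intro!: borel_measurable_abs meas)
  with meas show ?thesis by (simp add: l2_space_def)
qed

section \<open>The fundamental lemma of the calculus of variations\<close>

lemma flat_exp_1_bounds: "0 \<le> flat_exp 1 t" "flat_exp 1 t \<le> 1"
  by (auto simp: flat_exp_def)

lemma flat_exp_1_scaled_tendsto:
  "(\<lambda>n. flat_exp 1 (real (Suc n) * t)) \<longlonglongrightarrow> (if t > 0 then 1 else 0)"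
proof (cases "t > 0")
  case True
  have "(\<lambda>n. exp (- ((1 / t) * (1 / real (Suc n))))) \<longlonglongrightarrow> exp (- ((1 / t) * 0))"
    by (intro tendsto_intros LIMSEQ_Suc[OF lim_1_over_n])
  with True show ?thesis by (simp add: flat_exp_def mult.commute)
next
  case False
  then show ?thesis by (simp add: flat_exp_def zero_less_mult_iff)
qed

text \<open>Each factor is \<open>exp(-1/((n + 1) t))\<close>, with \<open>t\<close> the signed distance to a face. It vanishes on the
  outer side of the face and tends to 1 on the inner side as \<open>n\<close> grows.\<close>

definition box_bump :: "'a::euclidean_space \<Rightarrow> 'a \<Rightarrow> nat \<Rightarrow> 'a \<Rightarrow> real" where
  "box_bump a b n x = (\<Prod>i\<in>Basis. flat_exp 1 (real (Suc n) * (x \<bullet> i - a \<bullet> i)) *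
                                   flat_exp 1 (real (Suc n) * (b \<bullet> i - x \<bullet> i)))"

lemma box_bump_bounds: "0 \<le> box_bump a b n x" "box_bump a b n x \<le> 1"
  unfolding box_bump_def
  by (intro prod_nonneg prod_le_1 ballI mult_nonneg_nonneg mult_le_one conjI flat_exp_1_bounds)+

lemma box_bump_tendsto: "(\<lambda>n. box_bump a b n x) \<longlonglongrightarrow> indicator (box a b) x"
proof -
  have "(\<lambda>n. box_bump a b n x) \<longlonglongrightarrow>
      (\<Prod>i\<in>Basis. (if x \<bullet> i - a \<bullet> i > 0 then 1 else 0) * (if b \<bullet> i - x \<bullet> i > 0 then 1 else 0))"
    unfolding box_bump_def by (intro tendsto_prod tendsto_mult flat_exp_1_scaled_tendsto)
  also have "(\<Prod>i\<in>Basis. (if x \<bullet> i - a \<bullet> i > 0 then 1 else 0) * (if b \<bullet> i - x \<bullet> i > 0 then 1 else 0))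
      = (indicator (box a b) x :: real)"
    by (auto simp: indicator_def mem_box intro!: prod.neutral)
  finally show ?thesis .
qed

lemma test_function_box_bump:
  assumes "cbox a b \<subseteq> \<Omega>"
  shows "test_function \<Omega> (box_bump a b n)"
proof -
  have s: "k_smooth k (\<lambda>x. flat_exp 1 (real (Suc n) * (x \<bullet> i - a \<bullet> i)))"
    "k_smooth k (\<lambda>x. flat_exp 1 (real (Suc n) * (b \<bullet> i - x \<bullet> i)))" for k i
    using k_smooth_flat_exp[of k 1 "real (Suc n)" i "- real (Suc n) * (a \<bullet> i)"]
      k_smooth_flat_exp[of k 1 "- real (Suc n)" i "real (Suc n) * (b \<bullet> i)"]
    by (simp_all add: algebra_simps)
  have z: "box_bump a b n x = 0" if out: "x \<notin> cbox a b" for x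
  proof -
    obtain i where i: "i \<in> Basis" "\<not> (a \<bullet> i \<le> x \<bullet> i \<and> x \<bullet> i \<le> b \<bullet> i)" using out by (auto simp: mem_box)
    then have "flat_exp 1 (real (Suc n) * (x \<bullet> i - a \<bullet> i)) * flat_exp 1 (real (Suc n) * (b \<bullet> i - x \<bullet> i)) = 0"
      by (auto simp: flat_exp_def zero_less_mult_iff)
    then show ?thesis unfolding box_bump_def using i(1) by (intro prod_zero) auto
  qed
  have "k_smooth k (box_bump a b n)" for k
    unfolding box_bump_def by (intro k_smooth_prod k_smooth_mult s)
  with z assms show ?thesis unfolding test_function_def by (intro conjI allI exI[of _ "cbox a b"]) auto
qed

lemma sigma_finite_lebesgue: "sigma_finite_measure (lebesgue :: 'a::euclidean_space measure)"
proof
  show "\<exists>A. countable A \<and> A \<subseteq> sets (lebesgue :: 'a measure) \<and> \<Union>A = space lebesgue \<and>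
      (\<forall>a\<in>A. emeasure lebesgue a \<noteq> \<infinity>)"
    by (intro exI[of _ "range (\<lambda>n::nat. box (- (real n *\<^sub>R One)) (real n *\<^sub>R One))"])
      (simp add: UN_box_eq_UNIV image_subset_iff)
qed

text \<open>Open boxes generate the Borel sets and are closed under intersection, and Lebesgue sets differ
  from Borel sets by null sets; so the integral over every measurable set vanishes.\<close>

lemma integral_box_zero_imp_AE_zero:
  fixes F :: "'a::euclidean_space \<Rightarrow> real"
  assumes F: "integrable lebesgue F"
    and box: "\<And>a b. (LINT x|lebesgue. indicator (box a b) x * F x) = 0"
  shows "AE x in lebesgue. F x = 0"
proof (rule sigma_finite_measure.density_zero[OF sigma_finite_lebesgue F])
  have int: "integrable lebesgue (\<lambda>x. indicator A x * F x)" if "A \<in> sets lebesgue" for A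
    using integrable_mult_indicator[OF that F] by simp
  have UNIV: "(LINT x|lebesgue. F x) = 0"
  proof -
    have "(\<lambda>n. LINT x|lebesgue. indicator (box (- (real n *\<^sub>R One)) (real n *\<^sub>R One)) x * F x)
        \<longlonglongrightarrow> (LINT x|lebesgue. F x)"
    proof (rule integral_dominated_convergence[where w="\<lambda>x. norm (F x)"])
      show "AE x in lebesgue. (\<lambda>n. indicator (box (- (real n *\<^sub>R One)) (real n *\<^sub>R One)) x * F x) \<longlonglongrightarrow> F x"
      proof (rule AE_I2)
        fix x :: 'a
        have "x \<in> (\<Union>n::nat. box (- (real n *\<^sub>R One)) (real n *\<^sub>R One))"
          unfolding UN_box_eq_UNIV by simp
        then obtain m :: nat where m: "x \<in> box (- (real m *\<^sub>R One)) (real m *\<^sub>R One)" by blast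
        have "x \<in> box (- (real n *\<^sub>R One)) (real n *\<^sub>R One)" if "n \<ge> m" for n
          unfolding mem_box
        proof
          fix i :: 'a assume i: "i \<in> Basis"
          then have "- real m < x \<bullet> i \<and> x \<bullet> i < real m" using m by (auto simp: mem_box)
          then show "(- (real n *\<^sub>R One)) \<bullet> i < x \<bullet> i \<and> x \<bullet> i < (real n *\<^sub>R One) \<bullet> i" using i that by auto
        qed
        then have "eventually (\<lambda>n. indicator (box (- (real n *\<^sub>R One)) (real n *\<^sub>R One)) x * F x = F x) sequentially"
          by (intro eventually_sequentiallyI[of m]) simp
        then show "(\<lambda>n. indicator (box (- (real n *\<^sub>R One)) (real n *\<^sub>R One)) x * F x) \<longlonglongrightarrow> F x"
          by (rule tendsto_eventually)
      qed
    next
      show "(\<lambda>x. indicator (box (- (real n *\<^sub>R One)) (real n *\<^sub>R One)) x * F x)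
          \<in> borel_measurable lebesgue" for n :: nat
        by (intro borel_measurable_integrable int) simp
    qed (use F in \<open>auto simp: indicator_def\<close>)
    then have "(\<lambda>n. 0) \<longlonglongrightarrow> (LINT x|lebesgue. F x)" unfolding box .
    then show ?thesis using tendsto_const by (rule LIMSEQ_unique)
  qed
  have borel: "(LINT x|lebesgue. indicator A x * F x) = 0" if "A \<in> sets borel" for A
  proof -
    let ?E = "range (\<lambda>(a, b). box a b :: 'a set)"
    have sets: "A \<in> sets lebesgue" if "A \<in> sigma_sets UNIV ?E" for A
    proof -
      have "A \<in> sets borel" using that unfolding borel_eq_box by simp
      then show ?thesis by simp
    qed
    have "Int_stable ?E"
      by (auto simp: Int_stable_def box_Int_box)
    moreover have "?E \<subseteq> Pow UNIV" by simp
    moreover have "A \<in> sigma_sets UNIV ?E" using that by (simp add: borel_eq_box)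
    ultimately show ?thesis
    proof (induction rule: sigma_sets_induct_disjoint)
      case (basic A)
      then show ?case using box by auto
    next
      case empty
      then show ?case by simp
    next
      case (compl A)
      then have A: "A \<in> sets lebesgue" by (intro sets)
      have "(LINT x|lebesgue. indicator (UNIV - A) x * F x) = (LINT x|lebesgue. F x - indicator A x * F x)"
        by (intro Bochner_Integration.integral_cong) (auto simp: indicator_def)
      also have "\<dots> = 0" using compl(2) UNIV F int[OF A] by simp
      finally show ?case .
    next
      case (union A)
      have A: "A i \<in> sets lebesgue" for i
        using union.hyps(2) by (intro sets) auto
      have U: "(\<Union>i. A i) \<in> sets lebesgue" using A by blast
      have "set_lebesgue_integral lebesgue (\<Union>i. A i) F = (\<Sum>i. set_lebesgue_integral lebesgue (A i) F)"
      proof (rule lebesgue_integral_countable_add[OF A])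
        show "A i \<inter> A j = {}" if "i \<noteq> j" for i j
          using union(1) that by (simp add: disjoint_family_on_def)
        show "set_integrable lebesgue (\<Union>i. A i) F"
          using int[OF U] by (simp add: set_integrable_def)
      qed
      also have "\<dots> = 0" using union(3) by (simp add: set_lebesgue_integral_def)
      finally show ?case by (simp add: set_lebesgue_integral_def)
    qed
  qed
  fix A :: "'a set" assume A: "A \<in> sets lebesgue"
  then obtain S N N' where N: "A = S \<union> N" "N \<subseteq> N'" "N' \<in> null_sets lborel" "S \<in> sets lborel"
    by (rule sets_completionE)
  have "AE x in lebesgue. x \<notin> N'"
    using N(3) by (intro AE_not_in) (simp add: null_sets_completionI)
  then have "AE x in lebesgue. indicator A x * F x = indicator S x * F x"
    by eventually_elim (use N(1,2) in \<open>auto simp: indicator_def\<close>)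
  then have "(LINT x|lebesgue. indicator A x * F x) = (LINT x|lebesgue. indicator S x * F x)"
    using A N(4) by (intro integral_cong_AE borel_measurable_integrable int) auto
  then show "set_lebesgue_integral lebesgue A F = 0"
    using borel N(4) by (simp add: set_lebesgue_integral_def)
qed

text \<open>By dominated convergence along \<open>box_bump\<close>, the integral of \<open>G\<close> over every box with closure in \<open>\<Omega>\<close>
  is zero. Inside one such box all subboxes are admissible, so \<open>G\<close> vanishes there, and countably many
  closed boxes exhaust \<open>\<Omega>\<close>.\<close>

lemma fundamental_lemma_calculus_of_variations:
  fixes \<Omega> :: "'a::euclidean_space set"
  assumes "open \<Omega>"
    and G: "integrable (lebesgue_on \<Omega>) G"
    and zero: "\<And>\<psi>. test_function \<Omega> \<psi> \<Longrightarrow> (LINT x|lebesgue_on \<Omega>. G x * \<psi> x) = (0::real)"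
  shows "AE x in lebesgue_on \<Omega>. G x = 0"
proof -
  have \<Omega>: "\<Omega> \<in> sets lebesgue" using assms(1) by simp
  define H where "H = (\<lambda>x. indicator \<Omega> x * G x)"
  have H: "integrable lebesgue H"
    using G \<Omega> by (simp add: integrable_restrict_space H_def)
  have box: "(LINT x|lebesgue. indicator (box a b) x * H x) = 0" if "cbox a b \<subseteq> \<Omega>" for a b
  proof -
    have eq: "(LINT x|lebesgue_on \<Omega>. G x * \<psi> x) = (LINT x|lebesgue. \<psi> x * H x)" for \<psi>
      using \<Omega> by (simp add: integral_restrict_space H_def mult_ac)
    have "(\<lambda>n. LINT x|lebesgue. box_bump a b n x * H x) \<longlonglongrightarrow> (LINT x|lebesgue. indicator (box a b) x * H x)"
    proof (rule integral_dominated_convergence[where w="\<lambda>x. norm (H x)"])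
      show "(\<lambda>x. box_bump a b n x * H x) \<in> borel_measurable lebesgue" for n
        using test_function_borel[OF test_function_box_bump[OF that, of n]] H
        by (intro borel_measurable_times) (auto simp: measurable_completion)
      show "AE x in lebesgue. (\<lambda>n. box_bump a b n x * H x) \<longlonglongrightarrow> indicator (box a b) x * H x"
        by (intro AE_I2 tendsto_mult box_bump_tendsto tendsto_const)
      show "AE x in lebesgue. norm (box_bump a b n x * H x) \<le> norm (H x)" for n
        using box_bump_bounds[of a b n] by (auto simp: abs_mult intro!: mult_left_le_one_le)
    next
      show "(\<lambda>x. indicator (box a b) x * H x) \<in> borel_measurable lebesgue"
        using borel_measurable_integrable[OF integrable_mult_indicator[OF _ H, of "box a b"]] by simp
    qed (use H in simp)
    moreover have "(LINT x|lebesgue. box_bump a b n x * H x) = 0" for n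
      using zero[OF test_function_box_bump[OF that, of n]] unfolding eq .
    ultimately have "(\<lambda>n. 0) \<longlonglongrightarrow> (LINT x|lebesgue. indicator (box a b) x * H x)" by simp
    then show ?thesis using tendsto_const by (rule LIMSEQ_unique)
  qed
  \<comment> \<open>Multiplying by the indicator of \<open>box p q\<close> reduces arbitrary boxes to boxes with closure in \<open>\<Omega>\<close>.\<close>
  have on_cbox: "AE x in lebesgue. x \<in> cbox p q \<longrightarrow> H x = 0" if pq: "cbox p q \<subseteq> \<Omega>" for p q
  proof -
    have "AE x in lebesgue. indicator (box p q) x * H x = 0"
    proof (rule integral_box_zero_imp_AE_zero)
      show "integrable lebesgue (\<lambda>x. indicator (box p q) x * H x)"
        using integrable_mult_indicator[OF _ H, of "box p q"] by simp
      fix a b :: 'a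
      obtain c d where cd: "box a b \<inter> box p q = box c d" "cbox a b \<inter> cbox p q = cbox c d"
        by (rule that[OF box_Int_box Int_interval])
      have "(LINT x|lebesgue. indicator (box a b) x * (indicator (box p q) x * H x))
          = (LINT x|lebesgue. indicator (box c d) x * H x)"
        unfolding cd(1)[symmetric] by (simp add: indicator_inter_arith mult.assoc)
      also have "\<dots> = 0" by (rule box) (use cd(2) pq in auto)
      finally show "(LINT x|lebesgue. indicator (box a b) x * (indicator (box p q) x * H x)) = 0" .
    qed
    moreover have "AE x in lebesgue. x \<notin> cbox p q - box p q"
      using negligible_frontier_interval[of p q] by (intro AE_not_in) (simp add: negligible_iff_null_sets)
    ultimately show ?thesis by eventually_elim (auto simp: indicator_def)
  qed
  have "\<exists>\<D>. countable \<D> \<and> \<D> \<subseteq> Pow \<Omega> \<and> (\<forall>X\<in>\<D>. \<exists>a b. X = cbox a b) \<and> \<Union>\<D> = \<Omega>"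
  proof (rule open_countable_Union_open_cbox[OF assms(1)])
    fix \<D> :: "'a set set"
    assume "countable \<D>" "\<D> \<subseteq> Pow \<Omega>" "\<Union>\<D> = \<Omega>" and "\<And>X. X \<in> \<D> \<Longrightarrow> \<exists>a b. X = cbox a b"
    then show ?thesis by (intro exI[of _ \<D>] conjI ballI)
  qed
  then obtain \<D> where D: "countable \<D>" "\<D> \<subseteq> Pow \<Omega>" "\<forall>X\<in>\<D>. \<exists>a b. X = cbox a b"
    and cover: "\<Union>\<D> = \<Omega>"
    by (elim exE conjE)
  have "AE x in lebesgue. x \<in> X \<longrightarrow> H x = 0" if X: "X \<in> \<D>" for X
  proof -
    obtain a b where ab: "X = cbox a b" using bspec[OF D(3) X] by (elim exE)
    have "cbox a b \<subseteq> \<Omega>" using D(2) X ab by blast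
    then show ?thesis unfolding ab by (rule on_cbox)
  qed
  then have "AE x in lebesgue. \<forall>X\<in>\<D>. x \<in> X \<longrightarrow> H x = 0"
    by (rule AE_ball_countable'[OF _ D(1)])
  then have "AE x in lebesgue. x \<in> \<Omega> \<longrightarrow> G x = 0"
  proof (rule AE_mp, intro AE_I2 impI)
    fix x assume zero: "\<forall>X\<in>\<D>. x \<in> X \<longrightarrow> H x = 0" and x: "x \<in> \<Omega>"
    obtain X where "X \<in> \<D>" "x \<in> X" using x cover by blast
    then have "H x = 0" using zero by blast
    then show "G x = 0" using x by (simp add: H_def)
  qed
  then show ?thesis using \<Omega> by (simp add: AE_restrict_space_iff)
qed

section \<open>Integration by parts\<close>

lemma test_function_integrable:
  assumes "test_function \<Omega> \<psi>"
  shows "integrable lborel \<psi>"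
proof -
  obtain K where K: "compact K" "\<And>x. x \<notin> K \<Longrightarrow> \<psi> x = 0"
    using assms unfolding test_function_def by blast
  obtain M where M: "\<And>x. \<bar>\<psi> x\<bar> \<le> M" using test_function_bounded[OF assms] by blast
  show ?thesis
  proof (rule Bochner_Integration.integrable_bound)
    show "integrable lborel (\<lambda>x. M * indicator K x)"
      using K(1) by (intro integrable_mult_right integrable_real_indicator)
        (simp_all add: borel_compact emeasure_compact_finite[unfolded infinity_ennreal_def])
    show "\<psi> \<in> borel_measurable lborel" using test_function_borel[OF assms] by simp
    have "\<bar>\<psi> x\<bar> \<le> \<bar>M\<bar>" for x using M[of x] by linarith
    then show "AE x in lborel. norm (\<psi> x) \<le> norm (M * indicator K x)"
      using K(2) by (auto simp: indicator_def)
  qed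
qed

lemma directional_DERIV:
  assumes "\<And>x. \<psi> differentiable (at x)"
  shows "((\<lambda>t. \<psi> (x + t *\<^sub>R b)) has_real_derivative partial b \<psi> (x + t *\<^sub>R b)) (at t)"
proof -
  let ?D = "frechet_derivative \<psi> (at (x + t *\<^sub>R b))"
  have D: "(\<psi> has_derivative ?D) (at (x + t *\<^sub>R b))"
    using assms frechet_derivative_works by blast
  have "((\<lambda>t. x + t *\<^sub>R b) has_derivative (\<lambda>h. h *\<^sub>R b)) (at t)"
    by (auto intro!: derivative_eq_intros)
  from has_derivative_compose[OF this D]
  have "((\<lambda>t. \<psi> (x + t *\<^sub>R b)) has_derivative (\<lambda>h. ?D (h *\<^sub>R b))) (at t)" .
  moreover have "?D (h *\<^sub>R b) = partial b \<psi> (x + t *\<^sub>R b) * h" for h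
    using linear_scale[OF has_derivative_linear[OF D]] by (simp add: partial_def)
  ultimately show ?thesis by (simp add: has_field_derivative_def)
qed

lemma lborel_integral_shift:
  fixes \<psi> :: "'a::euclidean_space \<Rightarrow> real"
  assumes "\<psi> \<in> borel_measurable borel"
  shows "(LINT x|lborel. \<psi> (x + c)) = (LINT x|lborel. \<psi> x)"
    and "integrable lborel \<psi> \<Longrightarrow> integrable lborel (\<lambda>x. \<psi> (x + c))"
  using integral_distr[of "(+) c" lborel borel \<psi>] integrable_distr_eq[of "(+) c" lborel borel \<psi>] assms
  by (simp_all add: lborel_distr_plus add.commute)

text \<open>The difference quotients of \<open>\<psi>\<close> in direction \<open>b\<close> have integral 0 by translation invariance, and
  they converge boundedly, on a fixed bounded set, to the partial derivative. This avoids iterated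
  integrals.\<close>

lemma integral_partial_eq_0:
  fixes \<psi> :: "'a::euclidean_space \<Rightarrow> real"
  assumes test: "test_function \<Omega> \<psi>" and b: "b \<in> Basis"
  shows "(LINT x|lborel. partial b \<psi> x) = 0"
proof -
  note diff = test_functionD(1)[OF test]
  obtain K where K: "compact K" "\<And>x. x \<notin> K \<Longrightarrow> \<psi> x = 0"
    using test unfolding test_function_def by blast
  obtain R where R: "\<And>x. x \<in> K \<Longrightarrow> norm x \<le> R"
    using compact_imp_bounded[OF K(1)] unfolding bounded_iff by blast
  obtain M where M: "\<And>x. \<bar>partial b \<psi> x\<bar> \<le> M"
    using test_function_bounded[OF test_function_partial[OF test b]] by blast
  define h where "h = (\<lambda>n. 1 / real (Suc n))"
  have h: "h n > 0" "h n \<le> 1" for n by (auto simp: h_def)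
  define q where "q = (\<lambda>n x. (\<psi> (x + h n *\<^sub>R b) - \<psi> x) / h n)"
  have int: "integrable lborel \<psi>" by (rule test_function_integrable[OF test])
  have bor: "\<psi> \<in> borel_measurable borel" by (rule test_function_borel[OF test])
  have "(\<lambda>n. LINT x|lborel. q n x) \<longlonglongrightarrow> (LINT x|lborel. partial b \<psi> x)"
  proof (rule integral_dominated_convergence[where w="\<lambda>x. M * indicator (cball 0 (R + 1)) x"])
    show "partial b \<psi> \<in> borel_measurable lborel"
      using test_function_borel[OF test_function_partial[OF test b]] by simp
    show "q n \<in> borel_measurable lborel" for n
      unfolding q_def using int lborel_integral_shift(2)[OF bor int]
      by (intro borel_measurable_divide borel_measurable_diff borel_measurable_integrable) auto
    show "integrable lborel (\<lambda>x. M * indicator (cball 0 (R + 1)) x :: real)"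
      by (intro integrable_mult_right integrable_real_indicator)
        (simp_all add: emeasure_compact_finite[unfolded infinity_ennreal_def])
    show "AE x in lborel. (\<lambda>n. q n x) \<longlonglongrightarrow> partial b \<psi> x"
    proof (rule AE_I2)
      fix x
      have "((\<lambda>t. (\<psi> (x + t *\<^sub>R b) - \<psi> x) / t) \<longlongrightarrow> partial b \<psi> x) (at 0)"
        using directional_DERIV[OF diff, of x b 0] by (simp add: DERIV_def)
      moreover have "filterlim h (at 0) sequentially"
        unfolding filterlim_at h_def using LIMSEQ_Suc[OF lim_1_over_n] by simp
      ultimately show "(\<lambda>n. q n x) \<longlonglongrightarrow> partial b \<psi> x"
        unfolding q_def by (rule filterlim_compose)
    qed
    show "AE x in lborel. norm (q n x) \<le> M * indicator (cball 0 (R + 1)) x" for n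
    proof (rule AE_I2)
      fix x
      show "norm (q n x) \<le> M * indicator (cball 0 (R + 1)) x"
      proof (cases "x \<in> cball 0 (R + 1)")
        case True
        obtain z where z: "\<psi> (x + h n *\<^sub>R b) - \<psi> (x + 0 *\<^sub>R b) = (h n - 0) * partial b \<psi> (x + z *\<^sub>R b)"
          using MVT2[OF h(1)[of n], of "\<lambda>t. \<psi> (x + t *\<^sub>R b)" "\<lambda>t. partial b \<psi> (x + t *\<^sub>R b)"]
            directional_DERIV[OF diff] by blast
        have "q n x = partial b \<psi> (x + z *\<^sub>R b)"
          using z h(1)[of n] by (simp add: q_def)
        then show ?thesis using True M by simp
      next
        case False
        have "norm x \<le> norm (x + h n *\<^sub>R b) + norm (h n *\<^sub>R b)"
          using norm_triangle_ineq4[of "x + h n *\<^sub>R b" "h n *\<^sub>R b"] by simp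
        then have "norm x \<le> norm (x + h n *\<^sub>R b) + 1" using h[of n] b by simp
        then have "x \<notin> K" "x + h n *\<^sub>R b \<notin> K" using R[of x] R[of "x + h n *\<^sub>R b"] False by auto
        then show ?thesis using K False by (simp add: q_def)
      qed
    qed
  qed
  moreover have "(LINT x|lborel. q n x) = 0" for n
    using int lborel_integral_shift[OF bor] by (simp add: q_def)
  ultimately have "(\<lambda>n. 0) \<longlonglongrightarrow> (LINT x|lborel. partial b \<psi> x)" by simp
  then show ?thesis using tendsto_const by (rule LIMSEQ_unique)
qed

lemma test_function_integral_on:
  assumes "open \<Omega>" "test_function \<Omega> \<psi>"
  shows "(LINT x|lebesgue_on \<Omega>. \<psi> x) = (LINT x|lborel. \<psi> x)"
    and "integrable (lebesgue_on \<Omega>) \<psi>"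
proof -
  have eq: "indicator \<Omega> x *\<^sub>R \<psi> x = \<psi> x" for x
    using assms(2) by (auto simp: test_function_def indicator_def)
  have bor: "\<psi> \<in> borel_measurable lborel" using test_function_borel[OF assms(2)] by simp
  show "(LINT x|lebesgue_on \<Omega>. \<psi> x) = (LINT x|lborel. \<psi> x)"
    using assms(1) by (simp add: integral_restrict_space eq integral_completion[OF bor] del: real_scaleR_def)
  show "integrable (lebesgue_on \<Omega>) \<psi>"
    using assms(1) test_function_integrable[OF assms(2)]
    by (simp add: integrable_restrict_space eq integrable_completion[OF bor] del: real_scaleR_def)
qed

text \<open>Only one of the two functions needs compact support. The other one is a coordinate function in
  the proof of the Poincare inequality.\<close>

lemma integration_by_parts:
  assumes \<Omega>: "open \<Omega>" and test: "test_function \<Omega> \<psi>" and smooth: "\<And>k. k_smooth k \<eta>" and b: "b \<in> Basis"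
  shows "(LINT x|lebesgue_on \<Omega>. \<eta> x * partial b \<psi> x) = - (LINT x|lebesgue_on \<Omega>. partial b \<eta> x * \<psi> x)"
proof -
  have s: "k_smooth k (partial b \<eta>)" for k using smooth[of "Suc k"] b by simp
  have t: "test_function \<Omega> (\<lambda>x. \<eta> x * \<psi> x)" "test_function \<Omega> (\<lambda>x. \<eta> x * partial b \<psi> x)"
    "test_function \<Omega> (\<lambda>x. partial b \<eta> x * \<psi> x)"
    using test test_function_partial[OF test b] smooth s by (auto intro: test_function_mult)
  have "(LINT x|lebesgue_on \<Omega>. \<eta> x * partial b \<psi> x) + (LINT x|lebesgue_on \<Omega>. partial b \<eta> x * \<psi> x)
      = (LINT x|lebesgue_on \<Omega>. partial b (\<lambda>x. \<eta> x * \<psi> x) x)"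
    using test_function_integral_on(2)[OF \<Omega> t(2)] test_function_integral_on(2)[OF \<Omega> t(3)]
      test_functionD(1)[OF test] k_smooth_differentiable[OF smooth]
    by (simp add: partial_mult)
  also have "\<dots> = 0"
    using test_function_integral_on(1)[OF \<Omega> test_function_partial[OF t(1) b]] integral_partial_eq_0[OF t(1) b]
    by simp
  finally show ?thesis by simp
qed

section \<open>Weak gradients, the space H10 and the Poincare inequality\<close>

text \<open>Boundedness gives finite measure, hence \<open>L\<^sup>2 \<subseteq> L\<^sup>1\<close>, and the Poincare inequality; openness gives
  uniqueness of weak gradients.\<close>

locale bounded_open =
  fixes \<Omega> :: "'a::euclidean_space set"
  assumes open_domain: "open \<Omega>" and bounded_domain: "bounded \<Omega>"
begin

sublocale l2: semi_inner "l2_space \<Omega>" "l2_inner \<Omega>"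
  by (rule semi_inner_l2)

lemmas test_l2 = test_function_l2[OF open_domain bounded_domain]

lemma const_l2: "(\<lambda>x. b) \<in> l2_space \<Omega>"
proof -
  interpret finite_measure "lebesgue_on \<Omega>"
    using finite_measure_lebesgue_on_bounded[OF open_domain bounded_domain] .
  show ?thesis by (simp add: l2_space_def)
qed

lemma weak_gradient_l2: "is_weak_gradient \<Omega> g G \<Longrightarrow> G \<in> l2_space \<Omega>"
  by (simp add: is_weak_gradient_def)

lemma component_l2:
  assumes "G \<in> l2_space \<Omega>"
  shows "(\<lambda>x. G x \<bullet> b) \<in> l2_space \<Omega>"
proof -
  have m: "(\<lambda>x. G x \<bullet> b) \<in> borel_measurable (lebesgue_on \<Omega>)"
    using l2_spaceD(1)[OF assms] by (intro borel_measurable_inner borel_measurable_const)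
  have "integrable (lebesgue_on \<Omega>) (\<lambda>x. (norm (G x \<bullet> b))\<^sup>2)"
  proof (rule Bochner_Integration.integrable_bound)
    show "integrable (lebesgue_on \<Omega>) (\<lambda>x. (norm b)\<^sup>2 * (norm (G x))\<^sup>2)"
      by (intro integrable_mult_right l2_spaceD(2) assms)
    show "(\<lambda>x. (norm (G x \<bullet> b))\<^sup>2) \<in> borel_measurable (lebesgue_on \<Omega>)"
      unfolding real_norm_def by (intro borel_measurable_power borel_measurable_abs m)
    have "(norm (G x \<bullet> b))\<^sup>2 \<le> (norm b)\<^sup>2 * (norm (G x))\<^sup>2" for x
      using Cauchy_Schwarz_ineq2[of "G x" b] power_mono[of "\<bar>G x \<bullet> b\<bar>" "norm (G x) * norm b" 2]
      by (simp add: power_mult_distrib mult.commute)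
    then show "AE x in lebesgue_on \<Omega>. norm ((norm (G x \<bullet> b))\<^sup>2) \<le> norm ((norm b)\<^sup>2 * (norm (G x))\<^sup>2)"
      by simp
  qed
  with m show ?thesis by (simp add: l2_space_def)
qed

lemma weak_gradient_unique:
  assumes G: "is_weak_gradient \<Omega> g G" and G': "is_weak_gradient \<Omega> g G'"
  shows "AE x in lebesgue_on \<Omega>. G x = G' x"
proof -
  note l2 = component_l2[OF weak_gradient_l2[OF G]] component_l2[OF weak_gradient_l2[OF G']]
  have "AE x in lebesgue_on \<Omega>. (G x - G' x) \<bullet> b = 0" if b: "b \<in> Basis" for b
  proof (rule fundamental_lemma_calculus_of_variations[OF open_domain])
    show "integrable (lebesgue_on \<Omega>) (\<lambda>x. (G x - G' x) \<bullet> b)"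
      using l2_integrable_inner[OF weak_gradient_l2[OF G] const_l2[of b]]
        l2_integrable_inner[OF weak_gradient_l2[OF G'] const_l2[of b]]
      by (simp add: inner_diff_left)
    fix \<psi> :: "'a \<Rightarrow> real" assume \<psi>: "test_function \<Omega> \<psi>"
    have "(LINT x|lebesgue_on \<Omega>. (G x - G' x) \<bullet> b * \<psi> x)
        = (LINT x|lebesgue_on \<Omega>. (G x \<bullet> b) * \<psi> x) - (LINT x|lebesgue_on \<Omega>. (G' x \<bullet> b) * \<psi> x)"
      using l2_integrable_mult[OF l2(1) test_l2[OF \<psi>]] l2_integrable_mult[OF l2(2) test_l2[OF \<psi>]]
      by (simp add: inner_diff_left left_diff_distrib)
    also have "\<dots> = 0" using G G' \<psi> b unfolding is_weak_gradient_def by fastforce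
    finally show "(LINT x|lebesgue_on \<Omega>. (G x - G' x) \<bullet> b * \<psi> x) = 0" .
  qed
  then have "AE x in lebesgue_on \<Omega>. \<forall>b\<in>Basis. (G x - G' x) \<bullet> b = 0"
    by (rule AE_ball_countable'[OF _ countable_finite[OF finite_Basis]])
  then show ?thesis by eventually_elim (auto intro: euclidean_eqI simp: inner_diff_left)
qed

lemma weak_gradient_add:
  assumes g: "g \<in> l2_space \<Omega>" "is_weak_gradient \<Omega> g G" and h: "h \<in> l2_space \<Omega>" "is_weak_gradient \<Omega> h H"
  shows "is_weak_gradient \<Omega> (\<lambda>x. g x + h x) (\<lambda>x. G x + H x)"
  unfolding is_weak_gradient_def
proof (intro conjI allI impI)
  show "(\<lambda>x. G x + H x) \<in> l2_space \<Omega>" using g h by (intro l2_add weak_gradient_l2)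
  fix \<psi> :: "'a \<Rightarrow> real" and b :: 'a
  assume \<psi>: "test_function \<Omega> \<psi>" and b: "b \<in> Basis"
  note [simp] = l2_integrable_mult[OF g(1) test_l2[OF test_function_partial[OF \<psi> b]]]
    l2_integrable_mult[OF h(1) test_l2[OF test_function_partial[OF \<psi> b]]]
    l2_integrable_mult[OF component_l2[OF weak_gradient_l2[OF g(2)]] test_l2[OF \<psi>]]
    l2_integrable_mult[OF component_l2[OF weak_gradient_l2[OF h(2)]] test_l2[OF \<psi>]]
  have "(LINT x|lebesgue_on \<Omega>. g x * partial b \<psi> x) = - (LINT x|lebesgue_on \<Omega>. (G x \<bullet> b) * \<psi> x)"
    "(LINT x|lebesgue_on \<Omega>. h x * partial b \<psi> x) = - (LINT x|lebesgue_on \<Omega>. (H x \<bullet> b) * \<psi> x)"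
    using g(2) h(2) \<psi> b unfolding is_weak_gradient_def by blast+
  then show "(LINT x|lebesgue_on \<Omega>. (g x + h x) * partial b \<psi> x)
      = - (LINT x|lebesgue_on \<Omega>. ((G x + H x) \<bullet> b) * \<psi> x)"
    by (simp add: distrib_right inner_add_left)
qed

lemma weak_gradient_scale:
  assumes "is_weak_gradient \<Omega> g G"
  shows "is_weak_gradient \<Omega> (\<lambda>x. c * g x) (\<lambda>x. c *\<^sub>R G x)"
  using assms unfolding is_weak_gradient_def by (auto simp: l2_scale mult.assoc)

lemma weak_gradient_cong:
  assumes "ae_eq \<Omega> g h" "g \<in> l2_space \<Omega>" "h \<in> l2_space \<Omega>"
  shows "is_weak_gradient \<Omega> g = is_weak_gradient \<Omega> h"
proof -
  have "(LINT x|lebesgue_on \<Omega>. g x * partial b \<psi> x) = (LINT x|lebesgue_on \<Omega>. h x * partial b \<psi> x)"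
    if "test_function \<Omega> \<psi>" "b \<in> Basis" for \<psi> b
  proof (rule integral_cong_AE)
    note p = test_l2[OF test_function_partial[OF that]]
    show "(\<lambda>x. g x * partial b \<psi> x) \<in> borel_measurable (lebesgue_on \<Omega>)"
      "(\<lambda>x. h x * partial b \<psi> x) \<in> borel_measurable (lebesgue_on \<Omega>)"
      using l2_integrable_mult[OF assms(2) p] l2_integrable_mult[OF assms(3) p]
      by (simp_all add: borel_measurable_integrable)
    show "AE x in lebesgue_on \<Omega>. g x * partial b \<psi> x = h x * partial b \<psi> x"
      using assms(1) unfolding ae_eq_def by eventually_elim simp
  qed
  then show ?thesis unfolding is_weak_gradient_def fun_eq_iff by auto
qed

lemma wgrad_cong:
  "ae_eq \<Omega> g h \<Longrightarrow> g \<in> l2_space \<Omega> \<Longrightarrow> h \<in> l2_space \<Omega> \<Longrightarrow> wgrad \<Omega> g = wgrad \<Omega> h"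
  by (simp add: wgrad_def weak_gradient_cong)

lemma h1_l2: "g \<in> h1_space \<Omega> \<Longrightarrow> g \<in> l2_space \<Omega>"
  by (simp add: h1_space_def)

lemma wgrad_weak_gradient: "g \<in> h1_space \<Omega> \<Longrightarrow> is_weak_gradient \<Omega> g (wgrad \<Omega> g)"
proof -
  assume "g \<in> h1_space \<Omega>"
  then have "\<exists>G. is_weak_gradient \<Omega> g G" by (simp add: h1_space_def)
  then show ?thesis unfolding wgrad_def by (rule someI_ex)
qed

lemma wgrad_l2: "g \<in> h1_space \<Omega> \<Longrightarrow> wgrad \<Omega> g \<in> l2_space \<Omega>"
  using weak_gradient_l2 wgrad_weak_gradient by blast

lemma wgrad_eqI:
  assumes "is_weak_gradient \<Omega> g G"
  shows "AE x in lebesgue_on \<Omega>. wgrad \<Omega> g x = G x"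
proof (rule weak_gradient_unique[OF _ assms])
  show "is_weak_gradient \<Omega> g (wgrad \<Omega> g)" unfolding wgrad_def using assms by (rule someI[of "is_weak_gradient \<Omega> g" G])
qed

lemma h1_zero: "(\<lambda>x. 0) \<in> h1_space \<Omega>"
proof -
  have "is_weak_gradient \<Omega> (\<lambda>x. 0) (\<lambda>x. 0)" by (simp add: is_weak_gradient_def l2_zero)
  then show ?thesis unfolding h1_space_def using l2_zero by blast
qed

lemma h1_add: "g \<in> h1_space \<Omega> \<Longrightarrow> h \<in> h1_space \<Omega> \<Longrightarrow> (\<lambda>x. g x + h x) \<in> h1_space \<Omega>"
  unfolding h1_space_def using weak_gradient_add l2_add by blast

lemma h1_scale: "g \<in> h1_space \<Omega> \<Longrightarrow> (\<lambda>x. c * g x) \<in> h1_space \<Omega>"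
  unfolding h1_space_def using weak_gradient_scale l2.scale by blast

text \<open>Additivity of the chosen weak gradients, and therefore bilinearity of the form, holds because
  weak gradients are unique almost everywhere.\<close>

sublocale h1: semi_inner "h1_space \<Omega>" "h10_inner \<Omega>"
proof
  fix g h k :: "'a \<Rightarrow> real" and c :: real
  show "(\<lambda>x. 0) \<in> h1_space \<Omega>" by (rule h1_zero)
  show "0 \<le> h10_inner \<Omega> g g" by (simp add: h10_inner_def l2_inner_nonneg)
  show "h10_inner \<Omega> g h = h10_inner \<Omega> h g" by (simp add: h10_inner_def l2_inner_commute)
  assume g: "g \<in> h1_space \<Omega>"
  show scale: "(\<lambda>x. c * g x) \<in> h1_space \<Omega>" using g by (rule h1_scale)
  assume h: "h \<in> h1_space \<Omega>"
  show add: "(\<lambda>x. g x + h x) \<in> h1_space \<Omega>" using g h by (rule h1_add)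
  have "AE x in lebesgue_on \<Omega>. wgrad \<Omega> (\<lambda>x. c * g x) x = c *\<^sub>R wgrad \<Omega> g x"
    by (intro wgrad_eqI weak_gradient_scale wgrad_weak_gradient g)
  then have "l2_inner \<Omega> (wgrad \<Omega> (\<lambda>x. c * g x)) (wgrad \<Omega> h) = l2_inner \<Omega> (\<lambda>x. c *\<^sub>R wgrad \<Omega> g x) (wgrad \<Omega> h)"
    by (rule l2_inner_cong) (use g h scale in \<open>auto intro: wgrad_l2 l2_scale\<close>)
  then show "h10_inner \<Omega> (\<lambda>x. c * g x) h = c * h10_inner \<Omega> g h"
    by (simp add: h10_inner_def l2_inner_scale)
  assume k: "k \<in> h1_space \<Omega>"
  have "AE x in lebesgue_on \<Omega>. wgrad \<Omega> (\<lambda>x. g x + h x) x = wgrad \<Omega> g x + wgrad \<Omega> h x"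
    by (intro wgrad_eqI weak_gradient_add wgrad_weak_gradient h1_l2 g h)
  then have "l2_inner \<Omega> (wgrad \<Omega> (\<lambda>x. g x + h x)) (wgrad \<Omega> k)
      = l2_inner \<Omega> (\<lambda>x. wgrad \<Omega> g x + wgrad \<Omega> h x) (wgrad \<Omega> k)"
    by (rule l2_inner_cong) (use g h k add in \<open>auto intro: wgrad_l2 l2_add\<close>)
  then show "h10_inner \<Omega> (\<lambda>x. g x + h x) k = h10_inner \<Omega> g k + h10_inner \<Omega> h k"
    using g h k by (simp add: h10_inner_def l2_inner_add wgrad_l2)
qed

text \<open>The inner product behind \<open>h1_norm\<close>, which supplies the triangle inequality for the limits that
  define \<open>H\<^sup>1\<^sub>0\<close>.\<close>

sublocale h1_full: semi_inner "h1_space \<Omega>" "\<lambda>g h. l2_inner \<Omega> g h + h10_inner \<Omega> g h"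
proof
  fix g h :: "'a \<Rightarrow> real"
  show "l2_inner \<Omega> g h + h10_inner \<Omega> g h = l2_inner \<Omega> h g + h10_inner \<Omega> h g"
    by (simp add: h10_inner_def l2_inner_commute)
qed (simp_all add: h1.zero h1.add h1.scale h1.ip_add h1.ip_scale h1_l2 l2.ip_add l2.ip_scale
      h1.ip_nonneg l2_inner_nonneg distrib_left)

lemma h1_norm_eq: "h1_norm \<Omega> g = ip_norm (\<lambda>g h. l2_inner \<Omega> g h + h10_inner \<Omega> g h) g"
  by (simp add: h1_norm_def ip_norm_def h10_inner_def)

lemma norm_le_h1_norm:
  "ip_norm (l2_inner \<Omega>) g \<le> h1_norm \<Omega> g" "ip_norm (h10_inner \<Omega>) g \<le> h1_norm \<Omega> g"
  by (simp_all add: h1_norm_def ip_norm_def h10_inner_def l2_inner_nonneg)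

definition gradient :: "('a \<Rightarrow> real) \<Rightarrow> 'a \<Rightarrow> 'a" where
  "gradient \<psi> x = (\<Sum>b\<in>Basis. partial b \<psi> x *\<^sub>R b)"

lemma gradient_component: "b \<in> Basis \<Longrightarrow> gradient \<psi> x \<bullet> b = partial b \<psi> x"
  by (simp add: gradient_def)

lemma gradient_weak_gradient:
  assumes "test_function \<Omega> \<psi>"
  shows "is_weak_gradient \<Omega> \<psi> (gradient \<psi>)"
  unfolding is_weak_gradient_def
proof (intro conjI allI impI)
  have "(\<lambda>x. \<Sum>b\<in>B. partial b \<psi> x *\<^sub>R b) \<in> l2_space \<Omega>" if "finite B" "B \<subseteq> Basis" for B
    using that
  proof (induction B)
    case (insert b B)
    have p: "partial b \<psi> \<in> l2_space \<Omega>"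
      using insert.prems by (intro test_l2 test_function_partial assms) simp
    have "(\<lambda>x. partial b \<psi> x *\<^sub>R b) \<in> l2_space \<Omega>"
      using l2_spaceD[OF p] insert.prems
      by (auto simp: l2_space_def power_mult_distrib intro!: borel_measurable_scaleR)
    then show ?case using insert by (simp add: l2_add)
  qed (simp add: l2_zero)
  then show "gradient \<psi> \<in> l2_space \<Omega>" unfolding gradient_def[abs_def] by simp
  fix \<eta> :: "'a \<Rightarrow> real" and b :: 'a
  assume "test_function \<Omega> \<eta>" "b \<in> Basis"
  then show "(LINT x|lebesgue_on \<Omega>. \<psi> x * partial b \<eta> x)
      = - (LINT x|lebesgue_on \<Omega>. gradient \<psi> x \<bullet> b * \<eta> x)"
    using integration_by_parts[OF open_domain _ test_functionD(2)[OF assms], of \<eta> b]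
    by (simp add: gradient_component)
qed

lemma test_h1: "test_function \<Omega> \<psi> \<Longrightarrow> \<psi> \<in> h1_space \<Omega>"
  unfolding h1_space_def using gradient_weak_gradient test_l2 by blast

lemma h10_h1: "g \<in> h10_space \<Omega> \<Longrightarrow> g \<in> h1_space \<Omega>"
  by (simp add: h10_space_def)

lemma h10_zero: "(\<lambda>x. 0) \<in> h10_space \<Omega>"
proof -
  have "test_function \<Omega> (\<lambda>x. 0)"
    unfolding test_function_def by (auto simp: k_smooth_const intro!: exI[of _ "{}"])
  moreover have "h1_norm \<Omega> (\<lambda>x. 0) = 0"
    using h1_full.norm_scale[OF h1_zero, of 0] by (simp add: h1_norm_eq)
  ultimately show ?thesis unfolding h10_space_def
    by (intro CollectI conjI h1_zero exI[of _ "\<lambda>k x. 0"]) simp_all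
qed

lemma h10_add:
  assumes "g \<in> h10_space \<Omega>" "h \<in> h10_space \<Omega>"
  shows "(\<lambda>x. g x + h x) \<in> h10_space \<Omega>"
proof -
  obtain \<psi> \<eta> where \<psi>: "\<And>k. test_function \<Omega> (\<psi> k)" "(\<lambda>k. h1_norm \<Omega> (\<lambda>x. \<psi> k x - g x)) \<longlonglongrightarrow> 0"
    and \<eta>: "\<And>k. test_function \<Omega> (\<eta> k)" "(\<lambda>k. h1_norm \<Omega> (\<lambda>x. \<eta> k x - h x)) \<longlonglongrightarrow> 0"
    using assms unfolding h10_space_def by blast
  have V: "(\<lambda>x. \<psi> k x - g x) \<in> h1_space \<Omega>" "(\<lambda>x. \<eta> k x - h x) \<in> h1_space \<Omega>" for k
    using \<psi>(1) \<eta>(1) assms by (blast intro: h1.diff test_h1 h10_h1)+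
  have le: "h1_norm \<Omega> (\<lambda>x. (\<psi> k x + \<eta> k x) - (g x + h x))
      \<le> h1_norm \<Omega> (\<lambda>x. \<psi> k x - g x) + h1_norm \<Omega> (\<lambda>x. \<eta> k x - h x)" for k
    using h1_full.norm_add_le[OF V[of k]] by (simp add: h1_norm_eq algebra_simps)
  have nn: "0 \<le> h1_norm \<Omega> (\<lambda>x. (\<psi> k x + \<eta> k x) - (g x + h x))" for k
    by (simp add: h1_norm_def l2_inner_nonneg)
  have "(\<lambda>k. h1_norm \<Omega> (\<lambda>x. (\<psi> k x + \<eta> k x) - (g x + h x))) \<longlonglongrightarrow> 0"
    by (rule tendsto_sandwich[OF _ _ tendsto_const tendsto_add_zero[OF \<psi>(2) \<eta>(2)]])
      (simp_all add: nn le)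
  moreover have "test_function \<Omega> (\<lambda>x. \<psi> k x + \<eta> k x)" for k
    by (intro test_function_add \<psi> \<eta>)
  ultimately show ?thesis unfolding h10_space_def using assms
    by (intro CollectI conjI h1.add h10_h1 exI[of _ "\<lambda>k x. \<psi> k x + \<eta> k x"]) simp_all
qed

lemma h10_scale:
  assumes "g \<in> h10_space \<Omega>"
  shows "(\<lambda>x. c * g x) \<in> h10_space \<Omega>"
proof -
  obtain \<psi> where \<psi>: "\<And>k. test_function \<Omega> (\<psi> k)" "(\<lambda>k. h1_norm \<Omega> (\<lambda>x. \<psi> k x - g x)) \<longlonglongrightarrow> 0"
    using assms unfolding h10_space_def by blast
  have V: "(\<lambda>x. \<psi> k x - g x) \<in> h1_space \<Omega>" for k
    using \<psi>(1) assms by (intro h1.diff test_h1 h10_h1)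
  have "h1_norm \<Omega> (\<lambda>x. c * \<psi> k x - c * g x) = \<bar>c\<bar> * h1_norm \<Omega> (\<lambda>x. \<psi> k x - g x)" for k
    using h1_full.norm_scale[OF V[of k], of c] by (simp add: h1_norm_eq algebra_simps)
  then have "(\<lambda>k. h1_norm \<Omega> (\<lambda>x. c * \<psi> k x - c * g x)) \<longlonglongrightarrow> 0"
    using tendsto_mult_right_zero[OF \<psi>(2)] by simp
  moreover have "test_function \<Omega> (\<lambda>x. c * \<psi> k x)" for k
    by (intro test_function_mult \<psi> k_smooth_const)
  ultimately show ?thesis unfolding h10_space_def using assms
    by (intro CollectI conjI h1.scale h10_h1 exI[of _ "\<lambda>k x. c * \<psi> k x"]) simp_all
qed

lemma h10_cong:
  assumes "ae_eq \<Omega> g h" "g \<in> h10_space \<Omega>" "h \<in> l2_space \<Omega>"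
  shows "h \<in> h10_space \<Omega>"
proof -
  have g: "g \<in> l2_space \<Omega>" using assms h10_h1 h1_l2 by blast
  obtain \<psi> where \<psi>: "\<And>k. test_function \<Omega> (\<psi> k)" "(\<lambda>k. h1_norm \<Omega> (\<lambda>x. \<psi> k x - g x)) \<longlonglongrightarrow> 0"
    using assms unfolding h10_space_def by blast
  have "h1_norm \<Omega> (\<lambda>x. \<psi> k x - h x) = h1_norm \<Omega> (\<lambda>x. \<psi> k x - g x)" for k
  proof -
    have l2: "(\<lambda>x. \<psi> k x - h x) \<in> l2_space \<Omega>" "(\<lambda>x. \<psi> k x - g x) \<in> l2_space \<Omega>"
      using \<psi>(1) g assms(3) by (blast intro: l2.diff test_l2)+
    have ae: "ae_eq \<Omega> (\<lambda>x. \<psi> k x - h x) (\<lambda>x. \<psi> k x - g x)"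
      using assms(1) unfolding ae_eq_def by eventually_elim simp
    have "l2_inner \<Omega> (\<lambda>x. \<psi> k x - h x) (\<lambda>x. \<psi> k x - h x) = l2_inner \<Omega> (\<lambda>x. \<psi> k x - g x) (\<lambda>x. \<psi> k x - g x)"
      using ae l2 unfolding ae_eq_def by (intro l2_inner_cong) 
    then show ?thesis using wgrad_cong[OF ae l2] by (simp add: h1_norm_def)
  qed
  then have "(\<lambda>k. h1_norm \<Omega> (\<lambda>x. \<psi> k x - h x)) \<longlonglongrightarrow> 0" using \<psi>(2) by simp
  moreover have "h \<in> h1_space \<Omega>"
    using assms(2,3) weak_gradient_cong[OF assms(1) g assms(3)] unfolding h10_space_def h1_space_def by auto
  ultimately show ?thesis unfolding h10_space_def using \<psi>(1) by blast
qed

sublocale h10: semi_inner "h10_space \<Omega>" "h10_inner \<Omega>"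
  by standard
    (auto simp: h10_zero h10_add h10_scale h1.ip_add h1.ip_scale h10_h1 h1.ip_nonneg h1.ip_commute)

text \<open>Integrating \<open>x\<^sub>b \<partial>\<^sub>b(\<psi>\<^sup>2)\<close> by parts gives \<open>\<integral>\<psi>\<^sup>2 = - 2 \<integral>x\<^sub>b \<psi> \<partial>\<^sub>b\<psi>\<close>, and Young's inequality bounds the
  integrand on the right by \<open>\<psi>\<^sup>2/2 + 2 R\<^sup>2 (\<partial>\<^sub>b\<psi>)\<^sup>2\<close>.\<close>

lemma Poincare_test_function:
  assumes test: "test_function \<Omega> \<psi>" and R: "\<And>x. x \<in> \<Omega> \<Longrightarrow> norm x \<le> R" and "0 \<le> R"
  shows "l2_inner \<Omega> \<psi> \<psi> \<le> (2 * R)\<^sup>2 * h10_inner \<Omega> \<psi> \<psi>"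
proof -
  obtain b :: 'a where b: "b \<in> Basis" using nonempty_Basis by blast
  \<comment> \<open>One coordinate direction suffices.\<close>
  let ?p = "partial b \<psi>"
  have smooth: "k_smooth k \<psi>" for k by (rule test_functionD(2)[OF test])
  have p: "test_function \<Omega> ?p" by (rule test_function_partial[OF test b])
  have sq: "test_function \<Omega> (\<lambda>x. \<psi> x * \<psi> x)" by (intro test_function_mult test smooth)
  have psq: "partial b (\<lambda>x. \<psi> x * \<psi> x) = (\<lambda>x. \<psi> x * ?p x + ?p x * \<psi> x)"
    by (intro partial_mult test_functionD(1)[OF test])
  have "((\<lambda>x. x \<bullet> b) has_derivative (\<lambda>h. h \<bullet> b)) (at x)" for x
    by (rule has_derivative_inner_left[OF has_derivative_ident])
  then have "partial b (\<lambda>x. x \<bullet> b) x = b \<bullet> b" for x by (rule partial_eqI)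
  then have px: "partial b (\<lambda>x. x \<bullet> b) = (\<lambda>x. 1)" using b by (simp add: fun_eq_iff)
  have "(LINT x|lebesgue_on \<Omega>. (x \<bullet> b) * (\<psi> x * ?p x + ?p x * \<psi> x)) = - (LINT x|lebesgue_on \<Omega>. \<psi> x * \<psi> x)"
    using integration_by_parts[OF open_domain sq k_smooth_inner b, of b] by (simp add: psq px)
  moreover have test': "test_function \<Omega> (\<lambda>x. (x \<bullet> b) * (\<psi> x * ?p x + ?p x * \<psi> x))"
    using test_function_partial[OF sq b] by (intro test_function_mult k_smooth_inner) (simp add: psq)
  ultimately have "(LINT x|lebesgue_on \<Omega>. \<psi> x * \<psi> x)
      = (LINT x|lebesgue_on \<Omega>. - ((x \<bullet> b) * (\<psi> x * ?p x + ?p x * \<psi> x)))" by simp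
  also have "\<dots> \<le> (LINT x|lebesgue_on \<Omega>. \<psi> x * \<psi> x / 2 + 2 * R\<^sup>2 * (?p x * ?p x))"
  proof (rule integral_mono)
    show "integrable (lebesgue_on \<Omega>) (\<lambda>x. - ((x \<bullet> b) * (\<psi> x * ?p x + ?p x * \<psi> x)))"
      using test_function_integral_on(2)[OF open_domain test'] by simp
    show "integrable (lebesgue_on \<Omega>) (\<lambda>x. \<psi> x * \<psi> x / 2 + 2 * R\<^sup>2 * (?p x * ?p x))"
      using l2_integrable_mult[OF test_l2[OF test] test_l2[OF test]]
        l2_integrable_mult[OF test_l2[OF p] test_l2[OF p]] by simp
    fix x assume "x \<in> space (lebesgue_on \<Omega>)"
    then have "norm x \<le> R" using R by simp
    then have xb: "\<bar>x \<bullet> b\<bar> \<le> R" using Basis_le_norm[OF b, of x] by linarith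
    \<comment> \<open>Young's inequality as a completed square.\<close>
    have "0 \<le> (\<psi> x + 2 * (x \<bullet> b) * ?p x)\<^sup>2" by simp
    moreover have "(x \<bullet> b)\<^sup>2 * (?p x * ?p x) \<le> R\<^sup>2 * (?p x * ?p x)"
      using power_mono[OF xb, of 2] by (intro mult_right_mono) auto
    ultimately show "- ((x \<bullet> b) * (\<psi> x * ?p x + ?p x * \<psi> x)) \<le> \<psi> x * \<psi> x / 2 + 2 * R\<^sup>2 * (?p x * ?p x)"
      by (simp add: power2_eq_square algebra_simps)
  qed
  also have "\<dots> = (LINT x|lebesgue_on \<Omega>. \<psi> x * \<psi> x) / 2 + 2 * R\<^sup>2 * (LINT x|lebesgue_on \<Omega>. ?p x * ?p x)"
    using l2_integrable_mult[OF test_l2[OF test] test_l2[OF test]]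
        l2_integrable_mult[OF test_l2[OF p] test_l2[OF p]] by simp
  finally have "l2_inner \<Omega> \<psi> \<psi> \<le> (2 * R)\<^sup>2 * l2_inner \<Omega> ?p ?p"
    by (simp add: l2_inner_def power_mult_distrib)
  also have "l2_inner \<Omega> ?p ?p \<le> l2_inner \<Omega> (gradient \<psi>) (gradient \<psi>)"
    unfolding l2_inner_def
  proof (rule integral_mono)
    note g = weak_gradient_l2[OF gradient_weak_gradient[OF test]]
    show "integrable (lebesgue_on \<Omega>) (\<lambda>x. ?p x \<bullet> ?p x)"
      "integrable (lebesgue_on \<Omega>) (\<lambda>x. gradient \<psi> x \<bullet> gradient \<psi> x)"
      by (intro l2_integrable_inner test_l2 p g)+
    fix x
    show "?p x \<bullet> ?p x \<le> gradient \<psi> x \<bullet> gradient \<psi> x"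
      using power_mono[OF Basis_le_norm[OF b, of "gradient \<psi> x"], of 2]
      by (simp add: gradient_component[OF b] power2_norm_eq_inner flip: power2_eq_square)
  qed
  also have "l2_inner \<Omega> (gradient \<psi>) (gradient \<psi>) = h10_inner \<Omega> \<psi> \<psi>"
    unfolding h10_inner_def
    using wgrad_eqI[OF gradient_weak_gradient[OF test]] wgrad_l2[OF test_h1[OF test]]
      weak_gradient_l2[OF gradient_weak_gradient[OF test]]
    by (intro l2_inner_cong) (auto elim: eventually_mono)
  finally show ?thesis by (simp add: mult_left_mono)
qed

text \<open>Both sides are continuous in the \<open>H\<^sup>1\<close> norm, so the inequality passes from test functions to
  their limits.\<close>

lemma Poincare:
  "\<exists>C\<ge>0. \<forall>g\<in>h10_space \<Omega>. l2_inner \<Omega> g g \<le> C * h10_inner \<Omega> g g"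
proof -
  obtain R where R: "\<And>x. x \<in> \<Omega> \<Longrightarrow> norm x \<le> R" "0 < R"
    using bounded_domain unfolding bounded_pos by blast
  let ?L = "ip_norm (l2_inner \<Omega>)" and ?H = "ip_norm (h10_inner \<Omega>)"
  have "l2_inner \<Omega> g g \<le> (2 * R)\<^sup>2 * h10_inner \<Omega> g g" if g: "g \<in> h10_space \<Omega>" for g
  proof -
    obtain \<psi> where \<psi>: "\<And>k. test_function \<Omega> (\<psi> k)" "(\<lambda>k. h1_norm \<Omega> (\<lambda>x. \<psi> k x - g x)) \<longlonglongrightarrow> 0"
      using g unfolding h10_space_def by blast
    have "?L g \<le> 2 * R * ?H g + (2 * R + 1) * h1_norm \<Omega> (\<lambda>x. \<psi> k x - g x)" for k
    proof -
      let ?d = "\<lambda>x. \<psi> k x - g x"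
      have g1: "g \<in> h1_space \<Omega>" and \<psi>1: "\<psi> k \<in> h1_space \<Omega>" using g \<psi>(1) h10_h1 test_h1 by auto
      then have d: "?d \<in> h1_space \<Omega>" by (rule h1.diff[rotated])
      have "?L g \<le> ?L (\<psi> k) + ?L ?d"
        using l2.norm_add_le[OF h1_l2[OF \<psi>1] l2.scale[OF h1_l2[OF d], of "-1"]]
          l2.norm_scale[OF h1_l2[OF d], of "-1"] by simp
      moreover have "?L (\<psi> k) \<le> 2 * R * ?H (\<psi> k)"
        using real_sqrt_le_mono[OF Poincare_test_function[OF \<psi>(1) R(1) less_imp_le[OF R(2)], of k]] R(2)
        by (simp add: ip_norm_def real_sqrt_mult)
      moreover have "?H (\<psi> k) \<le> ?H g + ?H ?d"
        using h1.norm_add_le[OF g1 d] by simp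
      then have "2 * R * ?H (\<psi> k) \<le> 2 * R * (?H g + h1_norm \<Omega> ?d)"
        using R(2) norm_le_h1_norm(2)[of ?d] by (intro mult_left_mono) auto
      ultimately show ?thesis using norm_le_h1_norm(1)[of ?d] by (simp add: algebra_simps)
    qed
    moreover have "(\<lambda>k. 2 * R * ?H g + (2 * R + 1) * h1_norm \<Omega> (\<lambda>x. \<psi> k x - g x))
        \<longlonglongrightarrow> 2 * R * ?H g + (2 * R + 1) * 0"
      by (intro tendsto_intros \<psi>(2))
    ultimately have "?L g \<le> 2 * R * ?H g"
      by (intro LIMSEQ_le_const[of _ "2 * R * ?H g"]) auto
    then have "(?L g)\<^sup>2 \<le> (2 * R * ?H g)\<^sup>2"
      using l2.norm_nonneg[OF h1_l2[OF h10_h1[OF g]]] by (intro power_mono)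
    then show ?thesis
      by (simp only: power_mult_distrib l2.norm_square[OF h1_l2[OF h10_h1[OF g]]] h10.norm_square[OF g])
  qed
  then show ?thesis by (intro exI[of _ "(2 * R)\<^sup>2"]) auto
qed

text \<open>Projections in the two spaces are determined up to null functions of their own form. This
  equivalence allows both to be compared in one identity.\<close>

lemma h10_null_iff_l2_null:
  assumes "g \<in> h10_space \<Omega>"
  shows "h10_inner \<Omega> g g = 0 \<longleftrightarrow> l2_inner \<Omega> g g = 0"
proof
  obtain C where "l2_inner \<Omega> g g \<le> C * h10_inner \<Omega> g g" using Poincare assms by blast
  then show "h10_inner \<Omega> g g = 0 \<Longrightarrow> l2_inner \<Omega> g g = 0" using l2_inner_nonneg[of \<Omega> g] by simp
next
  note g = h1_l2[OF h10_h1[OF assms]]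
  assume "l2_inner \<Omega> g g = 0"
  then have "ae_eq \<Omega> g (\<lambda>x. 0)" using l2_null_iff[OF g] by (simp add: ae_eq_def)
  then have "wgrad \<Omega> g = wgrad \<Omega> (\<lambda>x. 0)" by (rule wgrad_cong[OF _ g l2_zero])
  then have "h10_inner \<Omega> g g = h10_inner \<Omega> (\<lambda>x. 0) (\<lambda>x. 0)" by (simp add: h10_inner_def)
  also have "\<dots> = 0" using h1.ip_scale[OF h1_zero h1_zero, of 0] by simp
  finally show "h10_inner \<Omega> g g = 0" .
qed

end

section \<open>Finite-dimensional subspaces and their projections\<close>

context bounded_open
begin

lemma l2_spanI: "g \<in> l2_space \<Omega> \<Longrightarrow> ae_eq \<Omega> g (\<lambda>x. \<Sum>b\<in>B. c b * b x) \<Longrightarrow> g \<in> l2_span \<Omega> B"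
  unfolding l2_span_def by (intro CollectI conjI exI[of _ c])

lemma l2_spanE:
  assumes "g \<in> l2_span \<Omega> B"
  obtains c where "g \<in> l2_space \<Omega>" "ae_eq \<Omega> g (\<lambda>x. \<Sum>b\<in>B. c b * b x)"
  using assms unfolding l2_span_def by (elim CollectE conjE exE)

lemma l2_span_zero: "(\<lambda>x. 0) \<in> l2_span \<Omega> B"
proof -
  have "ae_eq \<Omega> (\<lambda>x. 0) (\<lambda>x. \<Sum>b\<in>B. 0 * b x)" by (simp add: ae_eq_def)
  then show ?thesis by (rule l2_spanI[OF l2_zero])
qed

lemma l2_span_add:
  assumes "g \<in> l2_span \<Omega> B" "h \<in> l2_span \<Omega> B"
  shows "(\<lambda>x. g x + h x) \<in> l2_span \<Omega> B"
proof -
  from assms(1) obtain a where g: "g \<in> l2_space \<Omega>" and a: "ae_eq \<Omega> g (\<lambda>x. \<Sum>b\<in>B. a b * b x)"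
    by (rule l2_spanE)
  from assms(2) obtain c where h: "h \<in> l2_space \<Omega>" and c: "ae_eq \<Omega> h (\<lambda>x. \<Sum>b\<in>B. c b * b x)"
    by (rule l2_spanE)
  from a c have "ae_eq \<Omega> (\<lambda>x. g x + h x) (\<lambda>x. \<Sum>b\<in>B. (a b + c b) * b x)"
    unfolding ae_eq_def by eventually_elim (simp add: distrib_right sum.distrib)
  then show ?thesis by (rule l2_spanI[OF l2.add[OF g h]])
qed

lemma l2_span_scale:
  assumes "g \<in> l2_span \<Omega> B"
  shows "(\<lambda>x. k * g x) \<in> l2_span \<Omega> B"
proof -
  from assms obtain a where g: "g \<in> l2_space \<Omega>" and a: "ae_eq \<Omega> g (\<lambda>x. \<Sum>b\<in>B. a b * b x)"
    by (rule l2_spanE)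
  from a have "ae_eq \<Omega> (\<lambda>x. k * g x) (\<lambda>x. \<Sum>b\<in>B. (k * a b) * b x)"
    unfolding ae_eq_def by eventually_elim (simp add: sum_distrib_left mult.assoc)
  then show ?thesis by (rule l2_spanI[OF l2.scale[OF g]])
qed

lemma l2_span_superset:
  assumes "finite B" "B \<subseteq> l2_space \<Omega>" "b \<in> B"
  shows "b \<in> l2_span \<Omega> B"
proof -
  have "(\<Sum>b'\<in>B. (if b' = b then 1 else 0) * b' x) = b x" for x
  proof -
    have "(\<Sum>b'\<in>B. (if b' = b then 1 else 0) * b' x) = (\<Sum>b'\<in>B. if b' = b then b' x else 0)"
      by (intro sum.cong) auto
    then show ?thesis using assms by simp
  qed
  then have "ae_eq \<Omega> b (\<lambda>x. \<Sum>b'\<in>B. (if b' = b then 1 else 0) * b' x)" by (simp add: ae_eq_def)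
  then show ?thesis by (rule l2_spanI[OF subsetD[OF assms(2,3)]])
qed

lemma l2_span_subset_h10:
  assumes "B \<subseteq> h10_space \<Omega>"
  shows "l2_span \<Omega> B \<subseteq> h10_space \<Omega>"
proof
  fix g assume "g \<in> l2_span \<Omega> B"
  then obtain a where g: "g \<in> l2_space \<Omega>" and ae: "ae_eq \<Omega> g (\<lambda>x. \<Sum>b\<in>B. a b * b x)"
    by (rule l2_spanE)
  have "ae_eq \<Omega> (\<lambda>x. \<Sum>b\<in>B. a b * b x) g" using ae unfolding ae_eq_def by eventually_elim simp
  moreover have "(\<lambda>x. \<Sum>b\<in>B. a b * b x) \<in> h10_space \<Omega>"
    using assms by (intro h10.lincomb[of B "\<lambda>b. b"]) auto
  ultimately show "g \<in> h10_space \<Omega>" using g by (rule h10_cong)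
qed

lemma ae_zero_null:
  assumes "g \<in> h10_space \<Omega>" "AE x in lebesgue_on \<Omega>. g x = 0"
  shows "l2_inner \<Omega> g g = 0" "h10_inner \<Omega> g g = 0"
proof -
  show "l2_inner \<Omega> g g = 0" using l2_null_iff[OF h1_l2[OF h10_h1[OF assms(1)]]] assms(2) by (rule iffD2)
  with h10_null_iff_l2_null[OF assms(1)] show "h10_inner \<Omega> g g = 0" by (rule iffD2)
qed

context
  fixes B W
  assumes B: "finite B" "B \<subseteq> h10_space \<Omega>" and W: "W = l2_span \<Omega> B"
begin

lemma span_subset: "W \<subseteq> h10_space \<Omega>" "W \<subseteq> l2_space \<Omega>"
  using l2_span_subset_h10[OF B(2)] h10_h1 h1_l2 unfolding W by blast+

lemma span_generators: "B \<subseteq> W"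
  using l2_span_superset[OF B(1)] B(2) h10_h1 h1_l2 unfolding W by blast

lemma span_semi_inner: "semi_inner W (l2_inner \<Omega>)" "semi_inner W (h10_inner \<Omega>)"
  using span_subset unfolding W
  by (intro l2.subspace h10.subspace l2_span_zero l2_span_add l2_span_scale; simp)+

lemma span_approximation:
  assumes "v \<in> W"
  shows "\<exists>c. let n = (\<lambda>x. v x - (\<Sum>b\<in>B. c b * b x)) in l2_inner \<Omega> n n = 0"
    "\<exists>c. let n = (\<lambda>x. v x - (\<Sum>b\<in>B. c b * b x)) in h10_inner \<Omega> n n = 0"
proof -
  obtain c where c: "ae_eq \<Omega> v (\<lambda>x. \<Sum>b\<in>B. c b * b x)" using assms unfolding W by (rule l2_spanE)
  define n where "n = (\<lambda>x. v x - (\<Sum>b\<in>B. c b * b x))"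
  have n: "n \<in> h10_space \<Omega>"
    unfolding n_def using span_subset assms B(2) by (intro h10.diff h10.lincomb[of B "\<lambda>b. b"]) auto
  have "AE x in lebesgue_on \<Omega>. n x = 0"
    using c unfolding ae_eq_def n_def by eventually_elim simp
  from ae_zero_null[OF n this] show
    "\<exists>c. let n = (\<lambda>x. v x - (\<Sum>b\<in>B. c b * b x)) in l2_inner \<Omega> n n = 0"
    "\<exists>c. let n = (\<lambda>x. v x - (\<Sum>b\<in>B. c b * b x)) in h10_inner \<Omega> n n = 0"
    unfolding n_def Let_def by blast+
qed

lemma l2_projection:
  assumes "g \<in> l2_space \<Omega>"
  shows "orth_proj (l2_inner \<Omega>) W g \<in> W"
    "\<And>v. v \<in> W \<Longrightarrow> l2_inner \<Omega> (\<lambda>x. g x - orth_proj (l2_inner \<Omega>) W g x) v = 0"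
  using l2.orth_proj_works[OF span_semi_inner(1) span_subset(2) B(1) span_generators
      span_approximation(1) assms] by blast+

lemma h10_projection:
  assumes "g \<in> h10_space \<Omega>"
  shows "orth_proj (h10_inner \<Omega>) W g \<in> W"
    "\<And>v. v \<in> W \<Longrightarrow> h10_inner \<Omega> (\<lambda>x. g x - orth_proj (h10_inner \<Omega>) W g x) v = 0"
  using h10.orth_proj_works[OF span_semi_inner(2) span_subset(1) B(1) span_generators
      span_approximation(2) assms] by blast+

end

text \<open>Here \<open>p\<close> is the \<open>L\<^sup>2\<close>-projection of \<open>u\<close> and \<open>q\<close> its Ritz projection, for
  \<open>u = \<Sum>\<^sub>A a\<^sub>i \<phi>\<^sub>i + \<Sum>\<^sub>B a\<^sub>i \<phi>\<^sub>i\<close> with the modes in \<open>A\<close> belonging to \<open>W\<close> and those in \<open>B\<close>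
  being \<open>L\<^sup>2\<close>-orthogonal to \<open>W\<close>. By orthogonality \<open>p = \<Sum>\<^sub>A a\<^sub>i \<phi>\<^sub>i\<close>, by linearity
  \<open>q = \<Sum>\<^sub>A a\<^sub>i \<phi>\<^sub>i + \<Sum>\<^sub>B a\<^sub>i R\<^sub>i\<close>, in each case up to null functions, and the common first
  sum cancels in \<open>p - q\<close>.\<close>

lemma projection_difference_null:
  assumes W: "semi_inner W (l2_inner \<Omega>)" "W \<subseteq> h10_space \<Omega>"
    and modes: "\<And>i. i \<in> A \<Longrightarrow> \<phi> i \<in> W" "\<And>i. i \<in> B \<Longrightarrow> \<phi> i \<in> h10_space \<Omega>"
      "\<And>i v. i \<in> B \<Longrightarrow> v \<in> W \<Longrightarrow> l2_inner \<Omega> (\<phi> i) v = 0"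
    and u: "u \<in> h10_space \<Omega>" "ae_eq \<Omega> u (\<lambda>x. (\<Sum>i\<in>A. a i * \<phi> i x) + (\<Sum>i\<in>B. a i * \<phi> i x))"
    and p: "p \<in> W" "\<And>v. v \<in> W \<Longrightarrow> l2_inner \<Omega> (\<lambda>x. u x - p x) v = 0"
    and q: "q \<in> W" "\<And>v. v \<in> W \<Longrightarrow> h10_inner \<Omega> (\<lambda>x. u x - q x) v = 0"
    and R: "\<And>i. i \<in> B \<Longrightarrow> R i \<in> W"
      "\<And>i v. i \<in> B \<Longrightarrow> v \<in> W \<Longrightarrow> h10_inner \<Omega> (\<lambda>x. \<phi> i x - R i x) v = 0"
  defines "y \<equiv> \<lambda>x. (p x - q x) + (\<Sum>i\<in>B. a i * R i x)"
  shows "y \<in> W" "l2_inner \<Omega> y y = 0" "h10_inner \<Omega> y y = 0"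
proof -
  interpret W: semi_inner W "l2_inner \<Omega>" by (rule W)
  have H: "v \<in> h10_space \<Omega>" if "v \<in> W" for v using W(2) that by blast
  have L: "v \<in> l2_space \<Omega>" if "v \<in> h10_space \<Omega>" for v using that h10_h1 h1_l2 by blast
  define SA where "SA = (\<lambda>x. \<Sum>i\<in>A. a i * \<phi> i x)"
  define SB where "SB = (\<lambda>x. \<Sum>i\<in>B. a i * \<phi> i x)"
  define SR where "SR = (\<lambda>x. \<Sum>i\<in>B. a i * R i x)"
  define SE where "SE = (\<lambda>x. \<Sum>i\<in>B. a i * (\<phi> i x - R i x))"
  define n where "n = (\<lambda>x. u x - (SA x + SB x))"
  have S: "SA \<in> W" "SR \<in> W" "SB \<in> h10_space \<Omega>" "SE \<in> h10_space \<Omega>"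
    unfolding SA_def SR_def SB_def SE_def using modes R H
    by (auto intro!: W.lincomb h10.lincomb h10.diff[of "\<phi> _" "R _"])
  have n: "n \<in> h10_space \<Omega>" unfolding n_def by (intro h10.diff h10.add u S H)
  have "AE x in lebesgue_on \<Omega>. n x = 0"
    using u(2) unfolding ae_eq_def n_def SA_def SB_def by eventually_elim simp
  note null = ae_zero_null[OF n this]
  have up: "(\<lambda>x. u x - p x) \<in> h10_space \<Omega>" "(\<lambda>x. u x - q x) \<in> h10_space \<Omega>"
    by (intro h10.diff u H p q)+
  \<comment> \<open>The differences between the two projections and their expected values.\<close>
  define y1 where "y1 = (\<lambda>x. p x - SA x)"
  define y2 where "y2 = (\<lambda>x. (q x - SA x) - SR x)"
  have y12: "y1 \<in> W" "y2 \<in> W" unfolding y1_def y2_def by (intro W.diff p q S)+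
  have y1: "y1 = (\<lambda>x. (n x - (u x - p x)) + SB x)" by (simp add: y1_def n_def)
  have y2: "y2 = (\<lambda>x. (n x - (u x - q x)) + SE x)"
    by (rule ext) (simp add: y2_def n_def SE_def SB_def SR_def right_diff_distrib sum_subtractf)
  have "l2_inner \<Omega> y1 y1 = l2_inner \<Omega> n y1 - l2_inner \<Omega> (\<lambda>x. u x - p x) y1 + l2_inner \<Omega> SB y1"
    using l2.ip_add[OF l2.diff[OF L[OF n] L[OF up(1)]] L[OF S(3)] L[OF H[OF y12(1)]]]
      l2.ip_diff[OF L[OF n] L[OF up(1)] L[OF H[OF y12(1)]]] by (simp flip: y1)
  also have "\<dots> = 0"
  proof -
    have "l2_inner \<Omega> SB y1 = (\<Sum>i\<in>B. a i * l2_inner \<Omega> (\<phi> i) y1)"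
      unfolding SB_def by (intro l2.ip_lincomb L H y12 modes)
    also have "\<dots> = 0" using modes(3) y12(1) by simp
    finally show ?thesis using l2.ip_null[OF L[OF n] L[OF H[OF y12(1)]] null(1)] p(2)[OF y12(1)] by simp
  qed
  finally have n1: "l2_inner \<Omega> y1 y1 = 0" .
  have "h10_inner \<Omega> y2 y2 = h10_inner \<Omega> n y2 - h10_inner \<Omega> (\<lambda>x. u x - q x) y2 + h10_inner \<Omega> SE y2"
    using h10.ip_add[OF h10.diff[OF n up(2)] S(4) H[OF y12(2)]]
      h10.ip_diff[OF n up(2) H[OF y12(2)]] by (simp flip: y2)
  also have "\<dots> = 0"
  proof -
    have "h10_inner \<Omega> SE y2 = (\<Sum>i\<in>B. a i * h10_inner \<Omega> (\<lambda>x. \<phi> i x - R i x) y2)"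
      unfolding SE_def by (intro h10.ip_lincomb h10.diff H y12 modes R)
    also have "\<dots> = 0" using R(2) y12(2) by simp
    finally show ?thesis using h10.ip_null[OF n H[OF y12(2)] null(2)] q(2)[OF y12(2)] by simp
  qed
  finally have n2: "l2_inner \<Omega> y2 y2 = 0" using h10_null_iff_l2_null[OF H[OF y12(2)]] by simp
  have y: "y = (\<lambda>x. y1 x - y2 x)" by (rule ext) (simp add: y_def y1_def y2_def SR_def)
  show yW: "y \<in> W" unfolding y by (intro W.diff y12)
  have "l2_inner \<Omega> y y = l2_inner \<Omega> y1 y - l2_inner \<Omega> y2 y"
    using W.ip_diff[OF y12 yW] by (simp flip: y)
  also have "\<dots> = 0" using W.ip_null[OF y12(1) yW n1] W.ip_null[OF y12(2) yW n2] by simp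
  finally show "l2_inner \<Omega> y y = 0" .
  then show "h10_inner \<Omega> y y = 0" using h10_null_iff_l2_null[OF H[OF yW]] by simp
qed

end

section \<open>Proper orthogonal decomposition and the reduced order model\<close>

locale pod_rom = bounded_open \<Omega> for \<Omega> :: "'a::euclidean_space set" +
  fixes \<nu> T :: real and f :: "real \<Rightarrow> 'a \<Rightarrow> real" and d :: "'a rom_disc"
  assumes T_pos: "0 < T" and setting: "be_pod_rom \<Omega> \<nu> T f d"
begin

abbreviation "N \<equiv> levels d"
abbreviation "r \<equiv> rom_dim d"
abbreviation "s \<equiv> pod_rank d"
abbreviation "lam \<equiv> pod_eval d"
abbreviation "\<phi> \<equiv> pod_mode d"
abbreviation "u \<equiv> fe_sol d"
abbreviation "W \<equiv> rom_space \<Omega> d"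

text \<open>The inner product of \<open>S\<close> is the weighted Euclidean one with these weights. The first is 1, which
  makes \<open>(1, 0, ..., 0)\<close> a unit vector, whatever the time step.\<close>

definition weight :: "nat \<Rightarrow> real" where
  "weight k = (if k = 1 then 1 else time_step T d)"

lemma levels_ge_2: "2 \<le> N"
  using setting by (simp add: be_pod_rom_def)

lemma svd: "pod_svd \<Omega> T d"
  using setting by (simp add: be_pod_rom_def)

lemma time_step_pos: "0 < time_step T d"
  using levels_ge_2 T_pos by (simp add: time_step_def)

lemma s_inner_eq: "s_inner T d g h = (\<Sum>k\<in>{1..N}. weight k * g k * h k)"
proof -
  have "(\<Sum>k\<in>{1..N}. weight k * g k * h k) = weight 1 * g 1 * h 1 + (\<Sum>k\<in>{2..N}. weight k * g k * h k)"
    using levels_ge_2 sum.atLeast_Suc_atMost[of 1 N "\<lambda>k. weight k * g k * h k"] by (simp add: numeral_2_eq_2)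
  also have "(\<Sum>k\<in>{2..N}. weight k * g k * h k) = time_step T d * (\<Sum>k\<in>{2..N}. g k * h k)"
    unfolding sum_distrib_left by (intro sum.cong) (auto simp: weight_def)
  finally show ?thesis by (simp add: s_inner_def weight_def)
qed

lemma eval_nonneg: "1 \<le> i \<Longrightarrow> 0 \<le> lam i"
  and eval_antimono: "1 \<le> i \<Longrightarrow> i \<le> j \<Longrightarrow> lam j \<le> lam i"
  and eval_zero: "N < i \<Longrightarrow> lam i = 0"
  and mode_l2: "1 \<le> i \<Longrightarrow> \<phi> i \<in> l2_space \<Omega>"
  and mode_orthonormal: "1 \<le> i \<Longrightarrow> 1 \<le> j \<Longrightarrow> l2_inner \<Omega> (\<phi> i) (\<phi> j) = (if i = j then 1 else 0)"
  and pod_op_singular: "i \<in> {1..N} \<Longrightarrow>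
      ae_eq \<Omega> (pod_op T d (pod_coeff d i)) (\<lambda>x. sqrt (lam i) * \<phi> i x)"
  using svd unfolding pod_svd_def by blast+

lemma coeff_orthonormal:
  "i \<in> {1..N} \<Longrightarrow> j \<in> {1..N} \<Longrightarrow>
    (\<Sum>k\<in>{1..N}. weight k * pod_coeff d i k * pod_coeff d j k) = (if i = j then 1 else 0)"
  using svd unfolding pod_svd_def s_inner_eq by blast

text \<open>The rank is defined by counting; monotonicity of the eigenvalues makes it the last index with a
  positive eigenvalue.\<close>

lemma positive_eval_iff: "1 \<le> i \<Longrightarrow> 0 < lam i \<longleftrightarrow> i \<le> s"
proof -
  let ?A = "{i. 1 \<le> i \<and> 0 < lam i}"
  have "i \<le> N" if "i \<in> ?A" for i
    using that eval_zero[of i] by (cases "N < i") auto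
  then have "finite ?A" by (intro finite_subset[of ?A "{..N}"]) auto
  moreover have "i \<in> ?A" if "j \<in> ?A" "1 \<le> i" "i \<le> j" for i j
    using that eval_antimono[of i j] by auto
  ultimately have "?A = {1..s}"
    unfolding pod_rank_def by (intro down_closed_eq_atLeastAtMost_card) auto
  then have "i \<in> ?A \<longleftrightarrow> i \<in> {1..s}" by simp
  then show "1 \<le> i \<Longrightarrow> 0 < lam i \<longleftrightarrow> i \<le> s" by simp
qed

lemma rank_le_levels: "s \<le> N"
proof (cases "s = 0")
  case False
  then have "0 < lam s" using positive_eval_iff[of s] by simp
  then show ?thesis using eval_zero[of s] by (cases "N < s") auto
qed simp

lemma coeff_completeness:
  "k \<in> {1..N} \<Longrightarrow> (\<Sum>i\<in>{1..N}. pod_coeff d i 1 * pod_coeff d i k) = (if k = 1 then 1 else 0)"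
  "(\<Sum>i\<in>{1..N}. (pod_coeff d i 1)\<^sup>2) = 1"
proof -
  have w: "0 < weight k" for k using time_step_pos by (simp add: weight_def)
  have 1: "1 \<in> {1..N}" using levels_ge_2 by simp
  note complete = orthonormal_basis_complete[where f = "pod_coeff d" and w = weight and j = 1 and I="{1..N}" and J="{1..N}",
      OF finite_atLeastAtMost finite_atLeastAtMost refl w coeff_orthonormal 1]
  show "k \<in> {1..N} \<Longrightarrow> (\<Sum>i\<in>{1..N}. pod_coeff d i 1 * pod_coeff d i k) = (if k = 1 then 1 else 0)"
    using complete(1)[of k] by (simp add: weight_def)
  show "(\<Sum>i\<in>{1..N}. (pod_coeff d i 1)\<^sup>2) = 1"
    using complete(2) by (simp add: weight_def)
qed

text \<open>The initial condition is the image under \<open>pod_op\<close> of \<open>(1, 0, ..., 0)\<close>, whose coordinates with respect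
  to the right singular vectors are their first entries.\<close>

lemma initial_condition_pod_op:
  "u 1 x = (\<Sum>i\<in>{1..N}. pod_coeff d i 1 * pod_op T d (pod_coeff d i) x)"
proof -
  let ?c = "pod_coeff d" and ?q = "diff_quot T d u"
  have "(\<Sum>i\<in>{1..N}. ?c i 1 * pod_op T d (?c i) x)
      = (\<Sum>i\<in>{1..N}. ?c i 1 * ?c i 1) * u 1 x +
        (\<Sum>i\<in>{1..N}. \<Sum>j\<in>{1..N - 1}. (?c i 1 * ?c i (Suc j)) * (time_step T d * ?q j x))"
    by (simp add: pod_op_def distrib_left sum.distrib sum_distrib_left sum_distrib_right mult_ac)
  also have "(\<Sum>i\<in>{1..N}. \<Sum>j\<in>{1..N - 1}. (?c i 1 * ?c i (Suc j)) * (time_step T d * ?q j x))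
      = (\<Sum>j\<in>{1..N - 1}. (\<Sum>i\<in>{1..N}. ?c i 1 * ?c i (Suc j)) * (time_step T d * ?q j x))"
    unfolding sum_distrib_right by (rule sum.swap)
  also have "\<dots> = 0"
  proof (rule sum.neutral, rule ballI)
    fix j assume "j \<in> {1..N - 1}"
    then have "(\<Sum>i\<in>{1..N}. ?c i 1 * ?c i (Suc j)) = 0"
      using coeff_completeness(1)[of "Suc j"] by (auto simp: Suc_le_eq)
    then show "(\<Sum>i\<in>{1..N}. ?c i 1 * ?c i (Suc j)) * (time_step T d * ?q j x) = 0" by simp
  qed
  also have "(\<Sum>i\<in>{1..N}. ?c i 1 * ?c i 1) = 1"
    using coeff_completeness(1)[of 1] levels_ge_2 by simp
  finally show ?thesis by simp
qed

text \<open>The modes with \<open>i \<le> min r s\<close> lie in the ROM space, those with \<open>r < i \<le> s\<close> are orthogonal to it, and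
  modes beyond the rank carry the factor \<open>\<lambda>\<^sub>i = 0\<close>. If \<open>r \<ge> s\<close>, the second sum is empty.\<close>

lemma initial_condition_modes:
  "ae_eq \<Omega> (u 1) (\<lambda>x. (\<Sum>i\<in>{1..min r s}. (pod_coeff d i 1 * sqrt (lam i)) * \<phi> i x) +
                     (\<Sum>i\<in>{r + 1..s}. (pod_coeff d i 1 * sqrt (lam i)) * \<phi> i x))"
proof -
  let ?a = "\<lambda>i x. (pod_coeff d i 1 * sqrt (lam i)) * \<phi> i x"
  have split: "(\<Sum>i\<in>{1..N}. ?a i x) = (\<Sum>i\<in>{1..min r s}. ?a i x) + (\<Sum>i\<in>{r + 1..s}. ?a i x)" for x
  proof -
    have "(\<Sum>i\<in>{1..N}. ?a i x) = (\<Sum>i\<in>{1..s}. ?a i x)"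
    proof (rule sum.mono_neutral_right)
      show "\<forall>i\<in>{1..N} - {1..s}. ?a i x = 0"
      proof
        fix i assume i: "i \<in> {1..N} - {1..s}"
        then have "lam i = 0" using positive_eval_iff[of i] eval_nonneg[of i] by auto
        then show "?a i x = 0" by simp
      qed
    qed (use rank_le_levels in auto)
    also have "{1..s} = {1..min r s} \<union> {r + 1..s}" by auto
    also have "(\<Sum>i\<in>\<dots>. ?a i x) = (\<Sum>i\<in>{1..min r s}. ?a i x) + (\<Sum>i\<in>{r + 1..s}. ?a i x)"
      by (rule sum.union_disjoint) auto
    finally show ?thesis .
  qed
  have "AE x in lebesgue_on \<Omega>. \<forall>i\<in>{1..N}. pod_op T d (pod_coeff d i) x = sqrt (lam i) * \<phi> i x"
    using pod_op_singular unfolding ae_eq_def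
    by (rule AE_ball_countable'[OF _ countable_finite[OF finite_atLeastAtMost]])
  then have "AE x in lebesgue_on \<Omega>. u 1 x = (\<Sum>i\<in>{1..N}. ?a i x)"
    by eventually_elim (simp only: initial_condition_pod_op mult.assoc cong: sum.cong)
  then show ?thesis unfolding ae_eq_def split .
qed

lemma fe_space_subset: "fe_space d \<subseteq> h10_space \<Omega>"
proof -
  obtain B where "B \<subseteq> h10_space \<Omega>" "fe_space d = l2_span \<Omega> B"
    using setting unfolding be_pod_rom_def conforming_space_def by blast
  then show ?thesis using l2_span_subset_h10 by simp
qed

lemma fe_sol_h10: "n \<in> {1..N} \<Longrightarrow> u n \<in> h10_space \<Omega>"
  using setting fe_space_subset unfolding be_pod_rom_def backward_euler_def by blast

text \<open>A mode with positive eigenvalue is a multiple of \<open>K f\<^sub>i\<close>, a linear combination of finite element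
  functions, and these belong to \<open>H\<^sup>1\<^sub>0\<close>.\<close>

lemma mode_h10:
  assumes i: "1 \<le> i" "i \<le> s"
  shows "\<phi> i \<in> h10_space \<Omega>"
proof -
  have iN: "i \<in> {1..N}" using i rank_le_levels by simp
  let ?c = "pod_coeff d i"
  have pos: "0 < lam i" using i positive_eval_iff by simp
  have op: "pod_op T d ?c \<in> h10_space \<Omega>"
  proof -
    have "diff_quot T d u j \<in> h10_space \<Omega>" if "j \<in> {1..N - 1}" for j
    proof -
      have "(\<lambda>x. (1 / time_step T d) * (u (Suc j) x - u j x)) \<in> h10_space \<Omega>"
        using that by (intro h10.scale h10.diff fe_sol_h10) auto
      then show ?thesis by (simp add: diff_quot_def[abs_def])
    qed
    then have "(\<lambda>x. \<Sum>j=1..N - 1. (time_step T d * ?c (Suc j)) * diff_quot T d u j x) \<in> h10_space \<Omega>"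
      by (rule h10.lincomb)
    moreover have "(\<lambda>x. ?c 1 * u 1 x) \<in> h10_space \<Omega>"
      using levels_ge_2 by (intro h10.scale fe_sol_h10) auto
    ultimately show ?thesis
      unfolding pod_op_def[abs_def] by (rule h10.add[rotated])
  qed
  have "ae_eq \<Omega> (\<lambda>x. (1 / sqrt (lam i)) * pod_op T d ?c x) (\<phi> i)"
    using pod_op_singular[OF iN] unfolding ae_eq_def by eventually_elim (use pos in simp)
  then show ?thesis
    using h10.scale[OF op] mode_l2[OF i(1)] by (rule h10_cong)
qed

lemma rom_mode_h10: "i \<in> {1..r} \<Longrightarrow> \<phi> i \<in> h10_space \<Omega>"
  using setting fe_space_subset unfolding be_pod_rom_def by blast

lemma rom_generators: "finite (\<phi> ` {1..r})" "\<phi> ` {1..r} \<subseteq> h10_space \<Omega>"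
  using rom_mode_h10 by auto

lemmas rom = rom_generators rom_space_def
lemmas rom_subset = span_subset[OF rom]
lemmas rom_semi_inner = span_semi_inner[OF rom]
lemmas rom_l2_projection = l2_projection[OF rom]
lemmas rom_h10_projection = h10_projection[OF rom]

lemma rom_mode_mem: "i \<in> {1..r} \<Longrightarrow> \<phi> i \<in> W"
  using span_generators[OF rom] by blast

lemma mode_orthogonal_rom:
  assumes i: "r < i" and v: "v \<in> W"
  shows "l2_inner \<Omega> (\<phi> i) v = 0"
proof -
  obtain c where ae: "ae_eq \<Omega> v (\<lambda>x. \<Sum>b\<in>\<phi> ` {1..r}. c b * b x)"
    using v unfolding rom_space_def by (rule l2_spanE)
  define q where "q = (\<lambda>x. \<Sum>b\<in>\<phi> ` {1..r}. c b * b x)"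
  have i1: "1 \<le> i" using i by simp
  have B: "b \<in> l2_space \<Omega>" if "b \<in> \<phi> ` {1..r}" for b using that mode_l2 by auto
  have q: "q \<in> l2_space \<Omega>"
    unfolding q_def using B by (rule l2.lincomb)
  have "l2_inner \<Omega> q (\<phi> i) = (\<Sum>b\<in>\<phi> ` {1..r}. c b * l2_inner \<Omega> b (\<phi> i))"
    unfolding q_def by (rule l2.ip_lincomb[OF B mode_l2[OF i1]])
  also have "\<dots> = 0"
  proof (rule sum.neutral, rule ballI)
    fix b assume "b \<in> \<phi> ` {1..r}"
    then obtain j where "j \<in> {1..r}" "b = \<phi> j" by blast
    then show "c b * l2_inner \<Omega> b (\<phi> i) = 0" using mode_orthonormal[of j i] i by simp
  qed
  finally have "l2_inner \<Omega> q (\<phi> i) = 0" .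
  moreover have "l2_inner \<Omega> v (\<phi> i) = l2_inner \<Omega> q (\<phi> i)"
    using ae v rom_subset(2) q mode_l2[OF i1] unfolding ae_eq_def q_def by (intro l2_inner_cong) auto
  ultimately show ?thesis by (simp add: l2_inner_commute)
qed

abbreviation "R i \<equiv> ritz \<Omega> d (\<phi> i)"

lemma ritz_projection:
  assumes "g \<in> h10_space \<Omega>"
  shows "ritz \<Omega> d g \<in> W" "\<And>v. v \<in> W \<Longrightarrow> h10_inner \<Omega> (\<lambda>x. g x - ritz \<Omega> d g x) v = 0"
  unfolding ritz_def using rom_h10_projection[OF assms] by blast+

lemma high_mode_h10: "i \<in> {r + 1..s} \<Longrightarrow> \<phi> i \<in> h10_space \<Omega>"
  by (intro mode_h10) auto

lemma rom_initial_condition: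
  "rom_sol d 1 \<in> W" "\<And>v. v \<in> W \<Longrightarrow> l2_inner \<Omega> (\<lambda>x. u 1 x - rom_sol d 1 x) v = 0"
proof -
  have u: "u 1 \<in> l2_space \<Omega>" using fe_sol_h10[of 1] levels_ge_2 h10_h1 h1_l2 by auto
  note P = rom_l2_projection[OF u]
  show mem: "rom_sol d 1 \<in> W"
    using setting levels_ge_2 unfolding be_pod_rom_def backward_euler_def by auto
  have "ae_eq \<Omega> (rom_sol d 1) (orth_proj (l2_inner \<Omega>) W (u 1))"
    using setting unfolding be_pod_rom_def by blast
  then have ae: "AE x in lebesgue_on \<Omega>. u 1 x - rom_sol d 1 x = u 1 x - orth_proj (l2_inner \<Omega>) W (u 1) x"
    unfolding ae_eq_def by eventually_elim simp
  fix v assume v: "v \<in> W"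
  have "l2_inner \<Omega> (\<lambda>x. u 1 x - rom_sol d 1 x) v = l2_inner \<Omega> (\<lambda>x. u 1 x - orth_proj (l2_inner \<Omega>) W (u 1) x) v"
    using rom_subset(2) mem P(1) v u
    by (intro l2_inner_cong[OF ae]) (auto intro: l2.diff)
  then show "l2_inner \<Omega> (\<lambda>x. u 1 x - rom_sol d 1 x) v = 0" using P(2)[OF v] by simp
qed

text \<open>The weights \<open>c\<^sub>i\<close> in the expansion of \<open>u\<^sup>1\<close> have \<open>\<Sum>i. c\<^sub>i\<^sup>2 = 1\<close>, so the constant is 1 for every
  discretization.\<close>

lemma init_error_bound:
  "init_error_L2 \<Omega> d \<le> (\<Sum>i=r + 1..s. lam i * l2_inner \<Omega> (R i) (R i))"
  "init_error_H10 \<Omega> d \<le> (\<Sum>i=r + 1..s. lam i * h10_inner \<Omega> (R i) (R i))"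
proof -
  interpret WL: semi_inner W "l2_inner \<Omega>" by (rule rom_semi_inner)
  interpret WH: semi_inner W "h10_inner \<Omega>" by (rule rom_semi_inner)
  let ?B = "{r + 1..s}"
  let ?a = "\<lambda>i. pod_coeff d i 1 * sqrt (lam i)"
  have u: "u 1 \<in> h10_space \<Omega>" using fe_sol_h10[of 1] levels_ge_2 by simp
  have R: "R i \<in> W" "\<And>v. v \<in> W \<Longrightarrow> h10_inner \<Omega> (\<lambda>x. \<phi> i x - R i x) v = 0" if "i \<in> ?B" for i
    using ritz_projection[OF high_mode_h10[OF that]] by blast+
  have lc: "(\<lambda>x. \<Sum>i\<in>?B. ?a i * R i x) \<in> W" by (intro WL.lincomb R)
  let ?e = "discrete_rom_error \<Omega> d 1"
  have e: "?e = (\<lambda>x. rom_sol d 1 x - ritz \<Omega> d (u 1) x)" by (simp add: discrete_rom_error_def fun_eq_iff)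
  have eW: "?e \<in> W" unfolding e by (intro WL.diff rom_initial_condition ritz_projection u)
  have null: "l2_inner \<Omega> (\<lambda>x. ?e x + (\<Sum>i\<in>?B. ?a i * R i x)) (\<lambda>x. ?e x + (\<Sum>i\<in>?B. ?a i * R i x)) = 0"
    "h10_inner \<Omega> (\<lambda>x. ?e x + (\<Sum>i\<in>?B. ?a i * R i x)) (\<lambda>x. ?e x + (\<Sum>i\<in>?B. ?a i * R i x)) = 0"
    unfolding e
    using projection_difference_null(2,3)[OF rom_semi_inner(1) rom_subset(1), where A = "{1..min r s}"
        and B = ?B and \<phi> = \<phi> and a = ?a and u = "u 1" and p = "rom_sol d 1" and q = "ritz \<Omega> d (u 1)" and R = R,
        OF rom_mode_mem high_mode_h10 mode_orthogonal_rom u initial_condition_modes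
          rom_initial_condition ritz_projection[OF u] R]
    by auto
  have c: "(\<Sum>i\<in>?B. (pod_coeff d i 1)\<^sup>2) \<le> 1"
    unfolding coeff_completeness(2)[symmetric] using rank_le_levels by (intro sum_mono2) auto
  have sq: "(\<Sum>i\<in>?B. (sqrt (lam i))\<^sup>2 * g i) = (\<Sum>i\<in>?B. lam i * g i)" for g
    by (intro sum.cong) (auto simp: eval_nonneg)
  have "init_error_L2 \<Omega> d \<le> (ip_norm (l2_inner \<Omega>) (\<lambda>x. \<Sum>i\<in>?B. ?a i * R i x))\<^sup>2"
    unfolding init_error_L2_def
    by (intro power_mono WL.norm_null_perturbation[OF eW lc null(1)] WL.norm_nonneg eW)
  also have "\<dots> \<le> (\<Sum>i\<in>?B. (pod_coeff d i 1)\<^sup>2) * (\<Sum>i\<in>?B. (sqrt (lam i))\<^sup>2 * l2_inner \<Omega> (R i) (R i))"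
    by (rule WL.weighted_lincomb_le[OF R(1)])
  also have "\<dots> \<le> 1 * (\<Sum>i\<in>?B. (sqrt (lam i))\<^sup>2 * l2_inner \<Omega> (R i) (R i))"
    by (intro mult_right_mono[OF c] sum_nonneg mult_nonneg_nonneg zero_le_power2 l2_inner_nonneg)
  finally show "init_error_L2 \<Omega> d \<le> (\<Sum>i\<in>?B. lam i * l2_inner \<Omega> (R i) (R i))" by (simp only: sq mult_1)
  have "init_error_H10 \<Omega> d \<le> (ip_norm (h10_inner \<Omega>) (\<lambda>x. \<Sum>i\<in>?B. ?a i * R i x))\<^sup>2"
    unfolding init_error_H10_def
    by (intro power_mono WH.norm_null_perturbation[OF eW lc null(2)] WH.norm_nonneg eW)
  also have "\<dots> \<le> (\<Sum>i\<in>?B. (pod_coeff d i 1)\<^sup>2) * (\<Sum>i\<in>?B. (sqrt (lam i))\<^sup>2 * h10_inner \<Omega> (R i) (R i))"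
    by (rule WH.weighted_lincomb_le[OF R(1)])
  also have "\<dots> \<le> 1 * (\<Sum>i\<in>?B. (sqrt (lam i))\<^sup>2 * h10_inner \<Omega> (R i) (R i))"
    by (intro mult_right_mono[OF c] sum_nonneg mult_nonneg_nonneg zero_le_power2 WH.ip_nonneg R)
  finally show "init_error_H10 \<Omega> d \<le> (\<Sum>i\<in>?B. lam i * h10_inner \<Omega> (R i) (R i))" by (simp only: sq mult_1)
qed

lemma ritz_mode_error_eq: "ritz_mode_error \<Omega> d i = (\<lambda>x. \<phi> i x - R i x)"
  by (simp add: ritz_mode_error_def fun_eq_iff)

lemma rom_mem: "v \<in> W \<Longrightarrow> v \<in> h10_space \<Omega>" "v \<in> W \<Longrightarrow> v \<in> l2_space \<Omega>"
  using rom_subset by auto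

lemma ritz_mode_L2:
  assumes "i \<in> {r + 1..s}"
  shows "(ip_norm (l2_inner \<Omega>) (ritz_mode_error \<Omega> d i))\<^sup>2 = 1 + l2_inner \<Omega> (R i) (R i)"
proof -
  have \<phi>: "\<phi> i \<in> l2_space \<Omega>" using mode_l2[of i] assms by simp
  have RW: "R i \<in> W" by (rule ritz_projection(1)[OF high_mode_h10[OF assms]])
  then have Rl: "R i \<in> l2_space \<Omega>" by (rule rom_mem)
  have "l2_inner \<Omega> (\<phi> i) (R i) = 0" using mode_orthogonal_rom[OF _ RW] assms by simp
  then show ?thesis
    using mode_orthonormal[of i i] assms
    by (simp add: ritz_mode_error_eq l2.norm_square l2.diff \<phi> Rl l2.ip_diff l2.ip_diff_right
        l2_inner_commute[of \<Omega> "R i" "\<phi> i"])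
qed

lemma ritz_mode_H10:
  assumes "i \<in> {r + 1..s}"
  shows "h10_inner \<Omega> (\<phi> i) (\<phi> i) = (ip_norm (h10_inner \<Omega>) (ritz_mode_error \<Omega> d i))\<^sup>2 + h10_inner \<Omega> (R i) (R i)"
proof -
  note \<phi> = high_mode_h10[OF assms]
  have RW: "R i \<in> W" by (rule ritz_projection(1)[OF \<phi>])
  then have Rh: "R i \<in> h10_space \<Omega>" by (rule rom_mem)
  show ?thesis
    using h10.Pythagoras[OF \<phi> Rh ritz_projection(2)[OF \<phi> RW]]
    by (simp add: ritz_mode_error_eq h10.norm_square h10.diff \<phi> Rh)
qed

lemma mode_norm: "1 \<le> i \<Longrightarrow> (ip_norm (l2_inner \<Omega>) (\<phi> i))\<^sup>2 = 1"
  using mode_orthonormal[of i i] mode_l2[of i] by (simp add: l2.norm_square)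

text \<open>The \<open>L\<^sup>2\<close>-projection of a mode that is orthogonal to the ROM space is null. This makes the sums in
  optimal-I and optimal-II equal for \<open>Y = L\<^sup>2\<close>.\<close>

lemma mode_minus_projection_norm:
  assumes i: "r < i"
  shows "(ip_norm (l2_inner \<Omega>) (\<lambda>x. \<phi> i x - orth_proj (l2_inner \<Omega>) W (\<phi> i) x))\<^sup>2
    = (ip_norm (l2_inner \<Omega>) (\<phi> i))\<^sup>2"
proof -
  define p where "p = orth_proj (l2_inner \<Omega>) W (\<phi> i)"
  have \<phi>: "\<phi> i \<in> l2_space \<Omega>" using mode_l2[of i] i by simp
  have p: "p \<in> W" "l2_inner \<Omega> (\<lambda>x. \<phi> i x - p x) p = 0"
    unfolding p_def using rom_l2_projection[OF \<phi>] by blast+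
  have pl: "p \<in> l2_space \<Omega>" using p(1) by (rule rom_mem)
  have "l2_inner \<Omega> p p = 0"
    using p(2) mode_orthogonal_rom[OF i p(1)] l2.ip_diff[OF \<phi> pl pl] by simp
  then show ?thesis
    using l2.Pythagoras[OF \<phi> pl p(2)] by (simp add: l2.norm_square l2.diff \<phi> pl flip: p_def)
qed

lemma total_error_L2:
  assumes C0: "\<And>i. i \<in> {r + 1..s} \<Longrightarrow> ip_norm (l2_inner \<Omega>) (ritz_mode_error \<Omega> d i) \<le> C0"
  shows "disc_error_L2 \<Omega> d + init_error_L2 \<Omega> d
    \<le> 2 * C0\<^sup>2 * (\<Sum>i=r + 1..s. lam i * (ip_norm (l2_inner \<Omega>) (\<phi> i))\<^sup>2)"
proof -
  have "disc_error_L2 \<Omega> d + init_error_L2 \<Omega> d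
      \<le> (\<Sum>i=r + 1..s. lam i * ((ip_norm (l2_inner \<Omega>) (ritz_mode_error \<Omega> d i))\<^sup>2 + l2_inner \<Omega> (R i) (R i)))"
    using init_error_bound(1) by (simp add: disc_error_L2_def distrib_left sum.distrib)
  also have "\<dots> \<le> (\<Sum>i=r + 1..s. lam i * (2 * C0\<^sup>2))"
  proof (intro sum_mono mult_left_mono)
    fix i assume i: "i \<in> {r + 1..s}"
    have "0 \<le> ip_norm (l2_inner \<Omega>) (ritz_mode_error \<Omega> d i)" by (simp add: ip_norm_def l2_inner_nonneg)
    then have "(ip_norm (l2_inner \<Omega>) (ritz_mode_error \<Omega> d i))\<^sup>2 \<le> C0\<^sup>2"
      using C0[OF i] by (intro power_mono)
    then show "(ip_norm (l2_inner \<Omega>) (ritz_mode_error \<Omega> d i))\<^sup>2 + l2_inner \<Omega> (R i) (R i) \<le> 2 * C0\<^sup>2"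
      using ritz_mode_L2[OF i] by simp
    show "0 \<le> lam i" using i by (intro eval_nonneg) simp
  qed
  also have "\<dots> = 2 * C0\<^sup>2 * (\<Sum>i=r + 1..s. lam i * (ip_norm (l2_inner \<Omega>) (\<phi> i))\<^sup>2)"
    unfolding sum_distrib_left by (intro sum.cong) (auto simp: mode_norm)
  finally show ?thesis .
qed

lemma total_error_H10:
  assumes C: "0 \<le> C" "\<And>g. g \<in> h10_space \<Omega> \<Longrightarrow> l2_inner \<Omega> g g \<le> C * h10_inner \<Omega> g g"
  shows "disc_error_H10 \<Omega> d + init_error_H10 \<Omega> d
    \<le> (C + 1) * (\<Sum>i=r + 1..s. lam i * (ip_norm (h10_inner \<Omega>) (\<phi> i))\<^sup>2)"
proof -
  have "disc_error_H10 \<Omega> d + init_error_H10 \<Omega> d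
      \<le> (\<Sum>i=r + 1..s. lam i * (((ip_norm (l2_inner \<Omega>) (ritz_mode_error \<Omega> d i))\<^sup>2 +
            (ip_norm (h10_inner \<Omega>) (ritz_mode_error \<Omega> d i))\<^sup>2) + h10_inner \<Omega> (R i) (R i)))"
    using init_error_bound(2) by (simp add: disc_error_H10_def distrib_left sum.distrib)
  also have "\<dots> \<le> (\<Sum>i=r + 1..s. lam i * ((C + 1) * (ip_norm (h10_inner \<Omega>) (\<phi> i))\<^sup>2))"
  proof (intro sum_mono mult_left_mono)
    fix i assume i: "i \<in> {r + 1..s}"
    note \<phi> = high_mode_h10[OF i]
    have Rh: "R i \<in> h10_space \<Omega>" by (rule rom_mem(1)[OF ritz_projection(1)[OF \<phi>]])
    let ?e = "ritz_mode_error \<Omega> d i"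
    have e: "?e \<in> h10_space \<Omega>" unfolding ritz_mode_error_eq using \<phi> Rh by (rule h10.diff)
    have "(ip_norm (l2_inner \<Omega>) ?e)\<^sup>2 \<le> C * (ip_norm (h10_inner \<Omega>) ?e)\<^sup>2"
      using C(2)[OF e] by (simp add: h10.norm_square[OF e] l2.norm_square[OF h1_l2[OF h10_h1[OF e]]])
    also have "\<dots> \<le> C * h10_inner \<Omega> (\<phi> i) (\<phi> i)"
      using ritz_mode_H10[OF i] h10.ip_nonneg[OF Rh] C(1) by (intro mult_left_mono) auto
    finally show "((ip_norm (l2_inner \<Omega>) ?e)\<^sup>2 + (ip_norm (h10_inner \<Omega>) ?e)\<^sup>2) + h10_inner \<Omega> (R i) (R i)
        \<le> (C + 1) * (ip_norm (h10_inner \<Omega>) (\<phi> i))\<^sup>2"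
      using ritz_mode_H10[OF i] by (simp add: h10.norm_square[OF \<phi>] distrib_right)
    show "0 \<le> lam i" using i by (intro eval_nonneg) simp
  qed
  also have "\<dots> = (C + 1) * (\<Sum>i=r + 1..s. lam i * (ip_norm (h10_inner \<Omega>) (\<phi> i))\<^sup>2)"
    unfolding sum_distrib_left by (intro sum.cong) (auto simp: mult_ac)
  finally show ?thesis .
qed

end

theorem theorem4p8:
  fixes \<Omega> :: "'a::euclidean_space set" and \<nu> T :: real and f :: "real \<Rightarrow> 'a \<Rightarrow> real"
    and D :: "'a rom_disc set"
  assumes "bounded_lipschitz_domain \<Omega>" and "\<nu> > 0" and "T > 0"
    and "\<And>t. t \<in> {0..T} \<Longrightarrow> f t \<in> l2_space \<Omega>"
    and "\<And>d. d \<in> D \<Longrightarrow> be_pod_rom \<Omega> \<nu> T f d"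
  shows
    "((\<exists>C0. \<forall>d\<in>D. \<forall>i\<in>{rom_dim d + 1..pod_rank d}.
          ip_norm (l2_inner \<Omega>) (ritz_mode_error \<Omega> d i) \<le> C0)
        \<longrightarrow> optimal_I (l2_inner \<Omega>) D (disc_error_L2 \<Omega>) (init_error_L2 \<Omega>)) \<and>
     (optimal_I (l2_inner \<Omega>) D (disc_error_L2 \<Omega>) (init_error_L2 \<Omega>) \<longleftrightarrow>
      optimal_II \<Omega> (l2_inner \<Omega>) D (disc_error_L2 \<Omega>) (init_error_L2 \<Omega>)) \<and>
     optimal_I (h10_inner \<Omega>) D (disc_error_H10 \<Omega>) (init_error_H10 \<Omega>)"
proof -
  interpret bounded_open \<Omega>
    using assms(1) by unfold_locales (auto simp: bounded_lipschitz_domain_def)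
  have rom: "pod_rom \<Omega> \<nu> T f d" if "d \<in> D" for d
    using assms(3) assms(5)[OF that] by unfold_locales
  have "optimal_I (l2_inner \<Omega>) D (disc_error_L2 \<Omega>) (init_error_L2 \<Omega>)"
    if C0: "\<forall>d\<in>D. \<forall>i\<in>{rom_dim d + 1..pod_rank d}. ip_norm (l2_inner \<Omega>) (ritz_mode_error \<Omega> d i) \<le> C0" for C0
    unfolding optimal_I_def using C0
    by (intro exI[of _ "2 * C0\<^sup>2"] ballI pod_rom.total_error_L2[OF rom]) auto
  moreover have "(\<Sum>i=rom_dim d + 1..pod_rank d. pod_eval d i *
        (ip_norm (l2_inner \<Omega>) (\<lambda>x. pod_mode d i x - orth_proj (l2_inner \<Omega>) (rom_space \<Omega> d) (pod_mode d i) x))\<^sup>2)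
      = (\<Sum>i=rom_dim d + 1..pod_rank d. pod_eval d i * (ip_norm (l2_inner \<Omega>) (pod_mode d i))\<^sup>2)"
    if "d \<in> D" for d
    using pod_rom.mode_minus_projection_norm[OF rom[OF that]] by (intro sum.cong) auto
  then have "optimal_I (l2_inner \<Omega>) D (disc_error_L2 \<Omega>) (init_error_L2 \<Omega>) \<longleftrightarrow>
      optimal_II \<Omega> (l2_inner \<Omega>) D (disc_error_L2 \<Omega>) (init_error_L2 \<Omega>)"
    unfolding optimal_I_def optimal_II_def by simp
  moreover obtain C where "0 \<le> C" "\<forall>g\<in>h10_space \<Omega>. l2_inner \<Omega> g g \<le> C * h10_inner \<Omega> g g"
    using Poincare by blast
  then have "optimal_I (h10_inner \<Omega>) D (disc_error_H10 \<Omega>) (init_error_H10 \<Omega>)"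
    unfolding optimal_I_def
    by (intro exI[of _ "C + 1"] ballI pod_rom.total_error_H10[OF rom]) auto
  ultimately show ?thesis by blast
qed

end
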